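(* Let $w_1,w_2,w_3\in(-\infty,1)\setminus\{0\}$, $W=(w_1,w_2,w_3)$, $\Sigma=\mathbb{P}^1\setminus\{0,1,\infty\}$ with universal cover $\widetilde\Sigma$, and let $\xi_W$ be the trinoid potential. Let $\Phi$ be a solution on $\widetilde\Sigma$ of $d\Phi=\Phi\xi_W$, with $\Phi(p,\lambda)$ holomorphic and invertible in $\lambda\in\mathbb{C}^*$ for some base point $p\in\widetilde\Sigma$, and let $M_1(\lambda),M_2(\lambda),M_3(\lambda)$ be its monodromies around $0,1,\infty$. If $n_j=\tfrac12(1-\sqrt{1-w_j})$ satisfy \[ |n_1|+|n_2|+|n_3|\le 1,\quad |n_i|\le|n_j|+|n_k|,\quad |w_i|\le|w_j|+|w_k|\quad(\{i,j,k\}=\{1,2,3\}),\tag{$\ast$} \] then there is a finite set $S\subset\mathbb{S}^1$ such that for every $\lambda\in\mathbb{S}^1\setminus S$ the set $\{M_1(\lambda),M_2(\lambda),M_3(\lambda)\}$ is nondegenerate and simultaneously unitarizable. Conversely, if such a finite set $S$ exists, then the inequalities $(\ast)$ hold.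
   Context: The trinoid potential is the $\lambda$-dependent $\mathfrak{sl}_2(\mathbb{C})$-valued meromorphic 1-form on $\mathbb{P}^1$ \[ \xi_W=\begin{pmatrix}0&\lambda^{-1}dz\\ (\lambda-1)^2Q_W/dz&0\end{pmatrix},\qquad Q_W=\frac{w_3z^2-(w_1-w_2+w_3)z+w_1}{16z^2(z-1)^2}\,dz^2, \] so $Q_W$ has double poles at $0,1,\infty$ with quadratic residues $w_1/16,w_2/16,w_3/16$. The monodromy of $\Phi$ along a deck transformation $\tau$ is $M(\tau)=(\Phi\circ\tau)\Phi^{-1}$; the monodromy around a puncture is that of the deck transformation corresponding to a loop winding once around it. A finite set $\{M_j\}\subset\mathrm{GL}_2(\mathbb{C})$ is simultaneously unitarizable if some $C\in\mathrm{GL}_2(\mathbb{C})$ has $CM_jC^{-1}\in\mathrm{U}_2$ for all $j$, and nondegenerate if $M_iM_j\ne M_jM_i$ for some $i\ne j$. *)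

theory Defs
  imports "HOL-Analysis.Analysis"
begin

type_synonym cmat2 = "complex^2^2"

text \<open>Coefficient (w.r.t. dz) of the quadratic differential Q_W.\<close>
definition QW :: "real \<Rightarrow> real \<Rightarrow> real \<Rightarrow> complex \<Rightarrow> complex" where
  "QW w1 w2 w3 z =
     (of_real w3 * z^2 - of_real (w1 - w2 + w3) * z + of_real w1) / (16 * z^2 * (z - 1)^2)"

text \<open>Coefficient matrix (w.r.t. dz) of the trinoid potential xi_W at spectral parameter lam.\<close>
definition trinoid_pot :: "real \<Rightarrow> real \<Rightarrow> real \<Rightarrow> complex \<Rightarrow> complex \<Rightarrow> cmat2" where
  "trinoid_pot w1 w2 w3 lam z =
     vector [vector [0, inverse lam], vector [(lam - 1)^2 * QW w1 w2 w3 z, 0]]"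

text \<open>Y solves dY = Y xi along the piecewise smooth path g (pullback ODE), with Y(0) = X.\<close>
definition sol_along :: "(complex \<Rightarrow> cmat2) \<Rightarrow> (real \<Rightarrow> complex) \<Rightarrow> cmat2 \<Rightarrow> (real \<Rightarrow> cmat2) \<Rightarrow> bool" where
  "sol_along A g X Y \<longleftrightarrow>
     continuous_on {0..1} Y \<and> Y 0 = X \<and>
     (\<exists>K. finite K \<and> (\<forall>t\<in>{0..1} - K.
        (Y has_vector_derivative
           (Y t ** (\<chi> i j. A (g t) $ i $ j * vector_derivative g (at t)))) (at t within {0..1})))"

definition monodromy :: "(complex \<Rightarrow> cmat2) \<Rightarrow> (real \<Rightarrow> complex) \<Rightarrow> cmat2 \<Rightarrow> cmat2" where
  "monodromy A g X = (THE M. \<exists>Y. sol_along A g X Y \<and> M = Y 1 ** matrix_inv X)"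

definition loop0 :: "real \<Rightarrow> complex" where
  "loop0 t = (1/2) * exp (2 * of_real pi * \<i> * of_real t)"
definition loop1 :: "real \<Rightarrow> complex" where
  "loop1 t = 1 - (1/2) * exp (2 * of_real pi * \<i> * of_real t)"
definition loopinf :: "real \<Rightarrow> complex" where
  "loopinf = reversepath (loop0 +++ loop1)"

definition cnj_transpose :: "cmat2 \<Rightarrow> cmat2" where
  "cnj_transpose M = (\<chi> i j. cnj (M $ j $ i))"

definition unitary2 :: "cmat2 \<Rightarrow> bool" where
  "unitary2 U \<longleftrightarrow> U ** cnj_transpose U = mat 1"

definition simult_unitarizable :: "cmat2 set \<Rightarrow> bool" where
  "simult_unitarizable Ms \<longleftrightarrow>
     (\<exists>C. invertible C \<and> (\<forall>M\<in>Ms. unitary2 (C ** M ** matrix_inv C)))"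

definition nondegenerate :: "cmat2 set \<Rightarrow> bool" where
  "nondegenerate Ms \<longleftrightarrow> (\<exists>A\<in>Ms. \<exists>B\<in>Ms. A \<noteq> B \<and> A ** B \<noteq> B ** A)"

definition nn :: "real \<Rightarrow> real" where
  "nn w = (1 - sqrt (1 - w)) / 2"

definition trinoid_ineqs :: "real \<Rightarrow> real \<Rightarrow> real \<Rightarrow> bool" where
  "trinoid_ineqs w1 w2 w3 \<longleftrightarrow>
     \<bar>nn w1\<bar> + \<bar>nn w2\<bar> + \<bar>nn w3\<bar> \<le> 1 \<and>
     \<bar>nn w1\<bar> \<le> \<bar>nn w2\<bar> + \<bar>nn w3\<bar> \<and>
     \<bar>nn w2\<bar> \<le> \<bar>nn w1\<bar> + \<bar>nn w3\<bar> \<and>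
     \<bar>nn w3\<bar> \<le> \<bar>nn w1\<bar> + \<bar>nn w2\<bar> \<and>
     \<bar>w1\<bar> \<le> \<bar>w2\<bar> + \<bar>w3\<bar> \<and>
     \<bar>w2\<bar> \<le> \<bar>w1\<bar> + \<bar>w3\<bar> \<and>
     \<bar>w3\<bar> \<le> \<bar>w1\<bar> + \<bar>w2\<bar>"

end

theory Submission
  imports Defs "HOL-Complex_Analysis.Cauchy_Integral_Formula"
begin

text \<open>
  For \<open>\<lambda>\<close> on the unit circle put \<open>s = (1 - Re \<lambda>) / 2\<close>, so that \<open>\<lambda>\<^sup>-\<^sup>1 (\<lambda> - 1)\<^sup>2 = -4 s\<close>. The
  second component \<open>y\<close> of a row of \<open>\<Phi>\<close> satisfies \<open>y'' = -4 s Q y\<close>, with exponents \<open>\<nu>\<close>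
  and \<open>1 - \<nu>\<close> at the j-th puncture, \<open>\<nu> = nn (s w\<^sub>j)\<close>; hence the monodromies have determinant 1,
  product 1 and traces \<open>2 cos (2 \<pi> \<nu>)\<close>. The traces are obtained without Frobenius series: the
  trace of the transport along a circle around a puncture does not depend on the radius, and in
  the limit the equation becomes an Euler equation.

  Three such matrices are irreducible and simultaneously unitarizable iff
  \<open>1 - x\<^sup>2 - y\<^sup>2 - z\<^sup>2 + 2 x y z > 0\<close> for the half traces \<open>x, y, z\<close>. This discriminant is a
  product of four sines of the sum and the alternating sums of the numbers \<open>\<pi> \<bar>\<nu>\<bar>\<close>, which turns
  the theorem into a statement about the path \<open>s \<mapsto> (\<bar>nn (s w\<^sub>1)\<bar>, \<bar>nn (s w\<^sub>2)\<bar>, \<bar>nn (s w\<^sub>3)\<bar>)\<close>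
  staying inside a tetrahedron.
\<close>

unbundle no fps_syntax

section \<open>Unitarizable triples in SL(2,C)\<close>

text \<open>The seven inequalities are boundary data of the path. Those for the n_j locate its
  endpoint s = 1 (lambda = -1); those for the w_j describe its direction at s = 0 (lambda = 1),
  because \<open>nn (s * w)\<close> is s w / 4 to first order. The difficulty is to control all s in
  between. As a function of s, \<open>\<bar>nn (s * w)\<bar>\<close> is convex for w > 0 and concave
  for w < 0, so the triangle inequalities admit no uniform interpolation argument. If the long side
  belongs to a negative weight, the inequality is inherited from the slopes at s = 0. If it belongs
  to a positive weight, a failure at one s persists for all larger s, so the inequality is inherited
  from s = 1. In the converse, the same dichotomy shows that such a face, once reached, is crossed
  and not just touched. The indicial equation nu (1 - nu) = s w / 4, whose right side is linear in
  s, carries these comparisons. At infinity the differential equation needs no new coordinate: z^2 Q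
  has a limit there, and large circles around 0 are treated like small ones.\<close>

lemma mat2_eq_iff:
  "(A :: 'a^2^2) = B \<longleftrightarrow>
     A$1$1 = B$1$1 \<and> A$1$2 = B$1$2 \<and> A$2$1 = B$2$1 \<and> A$2$2 = B$2$2"
  unfolding vec_eq_iff forall_2 by blast

lemma mat2_mult_nth: "(A ** B) $ i $ j = A$i$1 * B$1$j + A$i$2 * B$2$j"
  for A B :: "'a::semiring_1^2^2"
  by (simp add: matrix_matrix_mult_def sum_2)

lemma trace_2: "trace (A :: 'a::comm_ring_1^2^2) = A$1$1 + A$2$2"
  by (simp add: trace_def sum_2)

lemma mat2_nth:
  "(mat c :: 'a::zero^2^2)$1$1 = c" "(mat c :: 'a^2^2)$1$2 = 0"
  "(mat c :: 'a^2^2)$2$1 = 0" "(mat c :: 'a^2^2)$2$2 = c"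
  by (simp_all add: mat_def)

lemmas mat2_simps = mat2_eq_iff mat2_mult_nth mat2_nth det_2 trace_2

text \<open>The adjugate. On SL(2) it is the inverse, but it is linear in A, so it can be
  differentiated along solutions without a quotient rule.\<close>

definition adj2 :: "'a::comm_ring_1^2^2 \<Rightarrow> 'a^2^2" where
  "adj2 A = vector [vector [A$2$2, - A$1$2], vector [- A$2$1, A$1$1]]"

lemma adj2_nth:
  "adj2 A $1$1 = A$2$2" "adj2 A $1$2 = - A$1$2" "adj2 A $2$1 = - A$2$1" "adj2 A $2$2 = A$1$1"
  by (simp_all add: adj2_def vector_2)

lemma adj2_mult: "adj2 (A ** B) = adj2 B ** adj2 A"
  by (simp add: mat2_simps adj2_nth algebra_simps)

lemma adj2_adj2 [simp]: "adj2 (adj2 A) = A"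
  by (simp add: mat2_simps adj2_nth)

lemma det_adj2 [simp]: "det (adj2 A) = det A"
  by (simp add: mat2_simps adj2_nth algebra_simps)

lemma mult_adj2: "det A = 1 \<Longrightarrow> A ** adj2 A = mat 1" "det A = 1 \<Longrightarrow> adj2 A ** A = mat 1"
  by (simp_all add: mat2_simps adj2_nth algebra_simps)

lemma matrix_inv_mult:
  assumes "invertible (A :: 'a::field^'n^'n)"
  shows "A ** matrix_inv A = mat 1" "matrix_inv A ** A = mat 1"
  using someI_ex[OF assms[unfolded invertible_def]] unfolding matrix_inv_def by blast+

lemma matrix_inv_eqI:
  fixes A B :: "'a::field^'n^'n"
  assumes "A ** B = mat 1"
  shows "matrix_inv A = B"
proof -
  have BA: "B ** A = mat 1" using assms matrix_left_right_inverse by blast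
  then have "A ** matrix_inv A = mat 1" using assms by (intro matrix_inv_mult) (auto simp: invertible_def)
  then have "B = B ** (A ** matrix_inv A)" by simp
  also have "\<dots> = matrix_inv A" using BA by (simp add: matrix_mul_assoc)
  finally show ?thesis by simp
qed

lemma matrix_inv_adj2: "det (A :: 'a::field^2^2) = 1 \<Longrightarrow> matrix_inv A = adj2 A"
  by (rule matrix_inv_eqI) (rule mult_adj2)

text \<open>Fricke's identity. For determinants 1 and half traces x, y, z the trace of the
  commutator is 2 minus four times the discriminant.\<close>

lemma trace_commutator_2:
  "trace (A ** B ** adj2 A ** adj2 B) = det B * (trace A)\<^sup>2 + det A * (trace B)\<^sup>2
     + (trace (A ** B))\<^sup>2 - trace A * trace B * trace (A ** B) - 2 * det A * det B"
  by (simp add: mat2_simps adj2_nth algebra_simps power2_eq_square)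

lemma conj_mult:
  assumes "invertible (C :: 'a::field^'n^'n)"
  shows "C ** (A ** B) ** matrix_inv C = (C ** A ** matrix_inv C) ** (C ** B ** matrix_inv C)"
proof -
  have "(C ** A ** matrix_inv C) ** (C ** B ** matrix_inv C)
      = C ** A ** (matrix_inv C ** C) ** B ** matrix_inv C"
    by (simp only: matrix_mul_assoc)
  then show ?thesis using assms by (simp add: matrix_inv_mult matrix_mul_assoc)
qed

lemma trace_conj:
  assumes "invertible (C :: 'a::field^'n^'n)"
  shows "trace (C ** A ** matrix_inv C) = trace A"
  using assms by (subst trace_mul_sym) (simp add: matrix_inv_mult matrix_mul_assoc)

lemma det_conj:
  assumes "invertible (C :: 'a::field^'n^'n)"
  shows "det (C ** A ** matrix_inv C) = det A"
proof -
  have "det C * det (matrix_inv C) = 1"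
    by (metis assms matrix_inv_mult(1) det_mul det_I)
  then show ?thesis by (simp add: det_mul)
qed

lemma conj_cancel:
  assumes "invertible (C :: 'a::field^'n^'n)"
  shows "matrix_inv C ** (C ** A ** matrix_inv C) ** C = A"
proof -
  have "matrix_inv C ** (C ** A ** matrix_inv C) ** C
      = (matrix_inv C ** C) ** A ** (matrix_inv C ** C)"
    by (simp only: matrix_mul_assoc)
  then show ?thesis using assms by (simp add: matrix_inv_mult)
qed

section \<open>Special unitary matrices and the discriminant\<close>

lemma SU2_nth:
  assumes "unitary2 U" "det U = 1"
  shows "U$2$2 = cnj (U$1$1)" "U$2$1 = - cnj (U$1$2)"
proof -
  have "cnj_transpose U = adj2 U"
    using assms matrix_inv_eqI matrix_inv_adj2 unfolding unitary2_def by metis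
  then have *: "cnj (U$1$1) = U$2$2" "cnj (U$1$2) = - U$2$1"
    by (auto simp: mat2_eq_iff adj2_nth cnj_transpose_def)
  show "U$2$2 = cnj (U$1$1)" "U$2$1 = - cnj (U$1$2)"
    unfolding * by simp_all
qed

text \<open>In quaternion coordinates the discriminant is the squared length of the cross product
  of the imaginary parts, which vanishes exactly for commuting elements.\<close>
lemma SU2_noncommuting_discriminant_pos:
  fixes x y z :: real
  assumes "unitary2 A" "det A = 1" "unitary2 B" "det B = 1"
    and tr: "trace A = of_real (2*x)" "trace B = of_real (2*y)" "trace (A ** B) = of_real (2*z)"
    and nc: "A ** B \<noteq> B ** A"
  shows "1 - x\<^sup>2 - y\<^sup>2 - z\<^sup>2 + 2*x*y*z > 0"
proof -
  note A = SU2_nth[OF assms(1,2)] and B = SU2_nth[OF assms(3,4)]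
  define a1 a2 a3 where a: "a1 = Im (A$1$1)" "a2 = Re (A$1$2)" "a3 = Im (A$1$2)"
  define b1 b2 b3 where b: "b1 = Im (B$1$1)" "b2 = Re (B$1$2)" "b3 = Im (B$1$2)"
  have x: "Re (A$1$1) = x" "Re (B$1$1) = y"
    using tr(1,2) by (simp_all add: trace_2 A B complex_eq_iff)
  have A11: "A$1$1 = Complex x a1" "A$1$2 = Complex a2 a3"
    using x a by (simp_all add: complex_eq_iff)
  have B11: "B$1$1 = Complex y b1" "B$1$2 = Complex b2 b3"
    using x b by (simp_all add: complex_eq_iff)
  have nA: "x\<^sup>2 + a1\<^sup>2 + a2\<^sup>2 + a3\<^sup>2 = 1"
    using assms(2) by (simp add: det_2 A A11 complex_eq_iff power2_eq_square)
  have nB: "y\<^sup>2 + b1\<^sup>2 + b2\<^sup>2 + b3\<^sup>2 = 1"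
    using assms(4) by (simp add: det_2 B B11 complex_eq_iff power2_eq_square)
  have z: "z = x*y - (a1*b1 + a2*b2 + a3*b3)"
    using tr(3) by (simp add: trace_2 mat2_mult_nth A B A11 B11 complex_eq_iff algebra_simps)
  have "1 - x\<^sup>2 - y\<^sup>2 - z\<^sup>2 + 2*x*y*z = (1-x\<^sup>2)*(1-y\<^sup>2) - (z-x*y)\<^sup>2"
    by (simp add: algebra_simps power2_eq_square)
  also have "\<dots> = (a1\<^sup>2 + a2\<^sup>2 + a3\<^sup>2) * (b1\<^sup>2 + b2\<^sup>2 + b3\<^sup>2) - (a1*b1 + a2*b2 + a3*b3)\<^sup>2"
  proof -
    have "1 - x\<^sup>2 = a1\<^sup>2 + a2\<^sup>2 + a3\<^sup>2" "1 - y\<^sup>2 = b1\<^sup>2 + b2\<^sup>2 + b3\<^sup>2"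
      using nA nB by simp_all
    moreover have "(z - x*y)\<^sup>2 = (a1*b1 + a2*b2 + a3*b3)\<^sup>2"
      unfolding z by (simp add: power2_eq_square algebra_simps)
    ultimately show ?thesis by simp
  qed
  also have "\<dots> = (a1*b2-a2*b1)\<^sup>2 + (a2*b3-a3*b2)\<^sup>2 + (a3*b1-a1*b3)\<^sup>2"
    by (simp add: algebra_simps power2_eq_square)
  finally have D: "1 - x\<^sup>2 - y\<^sup>2 - z\<^sup>2 + 2*x*y*z = \<dots>" .
  have "\<not> (a1*b2 = a2*b1 \<and> a2*b3 = a3*b2 \<and> a3*b1 = a1*b3)"
  proof
    assume *: "a1*b2 = a2*b1 \<and> a2*b3 = a3*b2 \<and> a3*b1 = a1*b3"
    have "A ** B = B ** A"
      using * by (simp add: mat2_eq_iff mat2_mult_nth A B A11 B11 complex_eq_iff mult.commute)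
    then show False using nc by simp
  qed
  then have "(a1*b2-a2*b1)\<^sup>2 > 0 \<or> (a2*b3-a3*b2)\<^sup>2 > 0 \<or> (a3*b1-a1*b3)\<^sup>2 > 0"
    by auto
  then show ?thesis unfolding D
    by (smt (verit) zero_le_power2)
qed

definition diag2 :: "'a::zero \<Rightarrow> 'a \<Rightarrow> 'a^2^2" where
  "diag2 a b = vector [vector [a, 0], vector [0, b]]"

lemma diag2_nth:
  "diag2 a b $1$1 = a" "diag2 a b $1$2 = 0" "diag2 a b $2$1 = 0" "diag2 a b $2$2 = b"
  by (simp_all add: diag2_def vector_2)

text \<open>The rows of K are left eigenvectors of A. The two explicit formulas for them degenerate
  when A is diagonal, which leaves the two orders of the diagonal entries as separate cases.\<close>

lemma diagonalize_2:
  fixes A :: "'a::field^2^2"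
  assumes tr: "trace A = m1 + m2" and det: "det A = m1 * m2" and ne: "m1 \<noteq> m2"
  obtains K where "invertible K" "K ** A = diag2 m1 m2 ** K"
proof -
  have eig: "(m1 - A$1$1) * (m1 - A$2$2) = A$1$2 * A$2$1"
      "(m2 - A$1$1) * (m2 - A$2$2) = A$1$2 * A$2$1"
  proof -
    have s: "A$2$2 = m1 + m2 - A$1$1" using tr by (simp add: trace_2 algebra_simps)
    show "(m1 - A$1$1) * (m1 - A$2$2) = A$1$2 * A$2$1" "(m2 - A$1$1) * (m2 - A$2$2) = A$1$2 * A$2$1"
      using det unfolding s det_2 by (simp_all add: algebra_simps)
  qed
  consider "A$2$1 \<noteq> 0" | "A$1$2 \<noteq> 0" | "A$2$1 = 0" "A$1$2 = 0" "A$1$1 = m1" 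
    | "A$2$1 = 0" "A$1$2 = 0" "A$2$2 = m1"
    using eig by force
  then show thesis
  proof cases
    case 1
    let ?K = "vector [vector [A$2$1, m1 - A$1$1], vector [A$2$1, m2 - A$1$1]] :: 'a^2^2"
    have "det ?K \<noteq> 0" using 1 ne by (simp add: det_2)
    moreover have "?K ** A = diag2 m1 m2 ** ?K"
      using eig by (simp add: mat2_simps diag2_nth algebra_simps)
    ultimately show thesis using that[of ?K] by (simp add: invertible_det_nz)
  next
    case 2
    let ?K = "vector [vector [m1 - A$2$2, A$1$2], vector [m2 - A$2$2, A$1$2]] :: 'a^2^2"
    have "det ?K \<noteq> 0" using 2 ne by (simp add: det_2)
    moreover have "?K ** A = diag2 m1 m2 ** ?K"
      using eig by (simp add: mat2_simps diag2_nth algebra_simps)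
    ultimately show thesis using that[of ?K] by (simp add: invertible_det_nz)
  next
    case 3
    then have "A = diag2 m1 m2" using tr by (simp add: mat2_simps diag2_nth)
    then show thesis using that[of "mat 1"] by (simp add: invertible_det_nz)
  next
    case 4
    let ?K = "vector [vector [0, 1], vector [1, 0]] :: 'a^2^2"
    have "A$1$1 = m2" using 4 tr by (simp add: trace_2 algebra_simps)
    then have "?K ** A = diag2 m1 m2 ** ?K" using 4
      by (simp add: mat2_simps diag2_nth)
    then show thesis using that[of ?K] by (simp add: invertible_det_nz det_2)
  qed
qed

lemma unitary2_mult: "unitary2 A \<Longrightarrow> unitary2 B \<Longrightarrow> unitary2 (A ** B)"
proof -
  assume A: "unitary2 A" and B: "unitary2 B"
  have "cnj_transpose (A ** B) = cnj_transpose B ** cnj_transpose A"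
    by (simp add: mat2_simps cnj_transpose_def algebra_simps)
  then have "(A ** B) ** cnj_transpose (A ** B) = A ** (B ** cnj_transpose B) ** cnj_transpose A"
    by (simp add: matrix_mul_assoc)
  then show ?thesis using A B by (simp add: unitary2_def)
qed

lemma unitary2_inverse:
  assumes "unitary2 A" "A ** B = mat 1"
  shows "unitary2 B"
proof -
  have "B = cnj_transpose A"
    using assms matrix_inv_eqI unfolding unitary2_def by metis
  moreover have "cnj_transpose (cnj_transpose A) = A"
    by (simp add: vec_eq_iff cnj_transpose_def)
  moreover have "cnj_transpose A ** A = mat 1"
    using assms(1) matrix_left_right_inverse unfolding unitary2_def by blast
  ultimately show ?thesis by (simp add: unitary2_def)
qed

text \<open>With A diagonal, the reality of the three traces forces the diagonal entries of B to be
  conjugate, and positivity of the discriminant says that the off-diagonal product is negative;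
  a diagonal rescaling then makes B unitary.\<close>
lemma unitarizable_if_discriminant_pos:
  fixes A B :: cmat2 and x y z :: real
  assumes det: "det A = 1" "det B = 1"
    and tr: "trace A = of_real (2*x)" "trace B = of_real (2*y)" "trace (A ** B) = of_real (2*z)"
    and x: "\<bar>x\<bar> \<le> 1" and D: "1 - x\<^sup>2 - y\<^sup>2 - z\<^sup>2 + 2*x*y*z > 0"
  obtains C where "invertible C" "unitary2 (C ** A ** matrix_inv C)" "unitary2 (C ** B ** matrix_inv C)"
proof -
  have D': "(1-x\<^sup>2)*(1-y\<^sup>2) > (z-x*y)\<^sup>2"
    using D by (simp add: algebra_simps power2_eq_square)
  have "x\<^sup>2 \<le> 1" using x by (simp add: abs_square_le_1)
  \<comment> \<open>\<open>D'\<close> excludes x^2 = 1, so A has two distinct eigenvalues on the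
    unit circle and can be diagonalized.\<close>
  moreover have "x\<^sup>2 \<noteq> 1" using D' by (smt (verit) mult_eq_0_iff zero_le_power2)
  ultimately have x1: "x\<^sup>2 < 1" by simp
  define si where "si = sqrt (1 - x\<^sup>2)"
  have si: "si > 0" "si\<^sup>2 = 1 - x\<^sup>2" using x1 by (simp_all add: si_def)
  define m where "m = Complex x si"
  have m: "m * cnj m = 1" "m + cnj m = of_real (2*x)" "m \<noteq> cnj m"
    using si by (simp_all add: m_def complex_eq_iff power2_eq_square)
  obtain K where K: "invertible K" "K ** A = diag2 m (cnj m) ** K"
    using diagonalize_2[of A m "cnj m"] m det tr by metis
  define B' where "B' = K ** B ** matrix_inv K"
  have A': "K ** A ** matrix_inv K = diag2 m (cnj m)"
    using K by (simp add: matrix_inv_mult flip: matrix_mul_assoc)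
  have detB': "det B' = 1" using det_conj[OF K(1)] det by (simp add: B'_def)
  have trB': "trace B' = of_real (2*y)" using trace_conj[OF K(1)] tr by (simp add: B'_def)
  have trAB': "trace (diag2 m (cnj m) ** B') = of_real (2*z)"
    using trace_conj[OF K(1), of "A ** B"] tr A' conj_mult[OF K(1), of A B] by (simp add: B'_def)
  define p q r s where pq: "p = B'$1$1" "q = B'$1$2" "r = B'$2$1" "s = B'$2$2"
  have ps: "p + s = of_real (2*y)" using trB' by (simp add: trace_2 pq)
  have mps: "m * p + cnj m * s = of_real (2*z)"
    using trAB' by (simp add: trace_2 mat2_mult_nth diag2_nth pq)
  have im: "Im s = - Im p" "Re s = 2 * y - Re p" using ps by (simp_all add: complex_eq_iff)
  have "si * Re p = si * y" using mps im by (simp add: m_def complex_eq_iff algebra_simps)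
  then have rp: "Re p = y" using si by simp
  have s: "s = cnj p" using im rp by (simp add: complex_eq_iff)
  have "z - x * y = - si * Im p"
    using mps by (simp add: m_def complex_eq_iff s rp algebra_simps)
  then have "(z - x*y)\<^sup>2 = si\<^sup>2 * (Im p)\<^sup>2" by (simp add: power_mult_distrib)
  then have "si\<^sup>2 * (Im p)\<^sup>2 < si\<^sup>2 * (1 - y\<^sup>2)" using D' si by (simp add: mult.commute)
  then have "(Im p)\<^sup>2 < 1 - y\<^sup>2"
    using si(1) by (simp only: mult_less_cancel_left_pos zero_less_power)
  then have np: "(cmod p)\<^sup>2 < 1" using rp by (simp add: cmod_power2)
  have "p * s - q * r = 1" using detB' by (simp add: det_2 pq)
  then have qr: "q * r = of_real ((cmod p)\<^sup>2 - 1)"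
    using complex_norm_square[of p] by (simp add: s algebra_simps)
  moreover have "of_real ((cmod p)\<^sup>2 - 1) \<noteq> (0 :: complex)"
    using np by (simp only: of_real_eq_0_iff)
  ultimately have q0: "q \<noteq> 0" by auto
  \<comment> \<open>Conjugation by diag (k, 1) turns the off-diagonal entries q, r into k q and r /
    k. These are negative conjugates of each other exactly if r = - k^2 cnj q, and q r = |p|^2 - 1
    then determines k^2.\<close>
  define \<rho> where "\<rho> = (1 - (cmod p)\<^sup>2) / (cmod q)\<^sup>2"
  have \<rho>: "\<rho> > 0" using np q0 by (simp add: \<rho>_def)
  define k where "k = sqrt \<rho>"
  have k: "k > 0" "k * k = \<rho>" using \<rho> by (simp_all add: k_def)
  have "q * r = - of_real \<rho> * (q * cnj q)"
    using q0 by (simp add: qr \<rho>_def flip: complex_norm_square)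
  then have "q * r = q * (- of_real (k * k) * cnj q)" by (simp add: k mult_ac)
  then have r: "r = - of_real (k * k) * cnj q" using q0 mult_left_cancel by blast
  define E where "E = diag2 (of_real k) 1 ** K"
  have invE: "matrix_inv E = matrix_inv K ** diag2 (inverse (of_real k)) 1"
  proof (rule matrix_inv_eqI)
    have "E ** (matrix_inv K ** diag2 (inverse (of_real k)) 1)
        = diag2 (of_real k) 1 ** (K ** matrix_inv K) ** diag2 (inverse (of_real k)) 1"
      by (simp add: E_def matrix_mul_assoc)
    also have "\<dots> = mat 1" using K k
      by (simp add: matrix_inv_mult mat2_simps diag2_nth)
    finally show "E ** (matrix_inv K ** diag2 (inverse (of_real k)) 1) = mat 1" .
  qed
  have "invertible E" using K k
    by (auto simp: E_def invertible_det_nz det_mul) (simp add: det_2 diag2_nth)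
  moreover have conjE: "E ** X ** matrix_inv E
      = diag2 (of_real k) 1 ** (K ** X ** matrix_inv K) ** diag2 (inverse (of_real k)) 1" for X
    unfolding invE unfolding E_def matrix_mul_assoc ..
  moreover have "unitary2 (E ** A ** matrix_inv E)"
    using m k unfolding conjE A'
    by (simp add: unitary2_def mat2_simps diag2_nth cnj_transpose_def field_simps)
  moreover have "unitary2 (E ** B ** matrix_inv E)"
  proof -
    have ent: "B'$1$1 = p" "B'$1$2 = q" "B'$2$1 = - of_real (k * k) * cnj q" "B'$2$2 = cnj p"
      using pq s r by simp_all
    have eq: "diag2 (of_real k) 1 ** B' ** diag2 (inverse (of_real k)) 1 =
        vector [vector [p, of_real k * q], vector [- of_real k * cnj q, cnj p]]"
      using k(1) by (simp add: mat2_simps diag2_nth ent field_simps)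
    have "p * cnj p + of_real k * of_real k * (q * cnj q) = 1"
      using \<open>p * s - q * r = 1\<close> unfolding s r of_real_mult by (simp add: mult_ac)
    then show ?thesis unfolding conjE B'_def[symmetric] eq
      by (simp add: unitary2_def mat2_simps cnj_transpose_def mult_ac add.commute)
  qed
  ultimately show thesis using that by blast
qed

text \<open>C is the inverse of A B: it becomes unitary together with A and B, and it commutes with
  both as soon as these commute. The bound on x selects the unitary triples, since the discriminant
  is also positive at x = y = z = 2.\<close>

theorem nondegenerate_unitarizable_iff:
  fixes A B C :: cmat2 and x y z :: real
  assumes det: "det A = 1" "det B = 1"
    and tr: "trace A = of_real (2*x)" "trace B = of_real (2*y)" "trace (A ** B) = of_real (2*z)"
    and x: "\<bar>x\<bar> \<le> 1" and C: "A ** B ** C = mat 1"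
  shows "nondegenerate {A, B, C} \<and> simult_unitarizable {A, B, C} \<longleftrightarrow>
    1 - x\<^sup>2 - y\<^sup>2 - z\<^sup>2 + 2*x*y*z > 0"
proof -
  have C': "C ** (A ** B) = mat 1" using C matrix_left_right_inverse by blast
  have nd: "A ** B \<noteq> B ** A" if "nondegenerate {A, B, C}"
  proof
    assume AB: "A ** B = B ** A"
    have "A ** C = (C ** (A ** B)) ** A ** C" using C' by simp
    also have "\<dots> = C ** A ** (B ** A) ** C" by (simp add: matrix_mul_assoc)
    also have "\<dots> = C ** A ** (A ** B ** C)" using AB by (simp add: matrix_mul_assoc)
    finally have AC: "A ** C = C ** A" using C by simp
    have "B ** C = (C ** (A ** B)) ** B ** C" using C' by simp
    also have "\<dots> = (C ** (B ** A)) ** B ** C" using AB by simp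
    also have "\<dots> = C ** B ** (A ** B ** C)" by (simp add: matrix_mul_assoc)
    finally have BC: "B ** C = C ** B" using C by simp
    show False using that AB AC BC unfolding nondegenerate_def by auto
  qed
  show ?thesis
  proof
    assume *: "nondegenerate {A, B, C} \<and> simult_unitarizable {A, B, C}"
    then obtain K where K: "invertible K" "unitary2 (K ** A ** matrix_inv K)"
        "unitary2 (K ** B ** matrix_inv K)"
      unfolding simult_unitarizable_def by auto
    have nc: "A ** B \<noteq> B ** A" using nd * by blast
    have "(K ** A ** matrix_inv K) ** (K ** B ** matrix_inv K) \<noteq>
        (K ** B ** matrix_inv K) ** (K ** A ** matrix_inv K)"
      using nc conj_cancel[OF K(1), of "A ** B"] conj_cancel[OF K(1), of "B ** A"]
      unfolding conj_mult[OF K(1), symmetric] by metis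
    then show "1 - x\<^sup>2 - y\<^sup>2 - z\<^sup>2 + 2*x*y*z > 0"
      using SU2_noncommuting_discriminant_pos[OF K(2) _ K(3), of x y z] det tr
      unfolding conj_mult[OF K(1), symmetric]
      by (simp add: det_conj[OF K(1)] trace_conj[OF K(1)])
  next
    assume D: "1 - x\<^sup>2 - y\<^sup>2 - z\<^sup>2 + 2*x*y*z > 0"
    obtain K where K: "invertible K" "unitary2 (K ** A ** matrix_inv K)"
        "unitary2 (K ** B ** matrix_inv K)"
      using unitarizable_if_discriminant_pos[OF det tr x D] by blast
    have "(K ** (A ** B) ** matrix_inv K) ** (K ** C ** matrix_inv K) = mat 1"
      unfolding conj_mult[OF K(1), symmetric] C using K by (simp add: matrix_inv_mult)
    then have "unitary2 (K ** C ** matrix_inv K)"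
      using unitary2_inverse unitary2_mult[OF K(2,3)] unfolding conj_mult[OF K(1)] by blast
    then have un: "simult_unitarizable {A, B, C}" using K unfolding simult_unitarizable_def by auto
    have "A ** B \<noteq> B ** A"
    proof
      assume AB: "A ** B = B ** A"
      \<comment> \<open>The commutator of commuting matrices has trace 2, so Fricke's identity makes
        the discriminant vanish.\<close>
      have "A ** B ** adj2 A ** adj2 B = A ** B ** adj2 (A ** B)"
        by (simp add: AB adj2_mult matrix_mul_assoc)
      also have "\<dots> = mat 1" using det by (simp add: mult_adj2 det_mul)
      finally have "of_real (4 * (1 - x\<^sup>2 - y\<^sup>2 - z\<^sup>2 + 2*x*y*z)) = (0 :: complex)"
        using trace_commutator_2[of A B] unfolding det tr
        by (simp add: trace_2 mat2_nth algebra_simps power2_eq_square)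
      then show False using D by (simp only: of_real_eq_0_iff) simp
    qed
    then have "nondegenerate {A, B, C}" unfolding nondegenerate_def by auto
    then show "nondegenerate {A, B, C} \<and> simult_unitarizable {A, B, C}" using un by simp
  qed
qed

section \<open>The discriminant along the unit circle\<close>

text \<open>The traces 2 cos (2 pi nu) do not see the sign of the exponent nu, so its absolute value
  suffices. At s = 1 it is the |n_j| of the inequalities.\<close>

definition exponent_gap :: "real \<Rightarrow> real \<Rightarrow> real" where
  "exponent_gap w s = \<bar>nn (s * w)\<bar>"

text \<open>The Gram determinant of three unit vectors with pairwise inner products x, y, z.\<close>

definition discr :: "real \<Rightarrow> real \<Rightarrow> real \<Rightarrow> real" where
  "discr x y z = 1 - x\<^sup>2 - y\<^sup>2 - z\<^sup>2 + 2*x*y*z"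

definition trinoid_discr :: "real \<Rightarrow> real \<Rightarrow> real \<Rightarrow> real \<Rightarrow> real" where
  "trinoid_discr w1 w2 w3 s =
     discr (cos (2 * pi * nn (s * w1))) (cos (2 * pi * nn (s * w2))) (cos (2 * pi * nn (s * w3)))"

lemma trinoid_discr_commute:
  "trinoid_discr w1 w2 w3 s = trinoid_discr w2 w1 w3 s"
  "trinoid_discr w1 w2 w3 s = trinoid_discr w3 w2 w1 s"
  by (simp_all add: trinoid_discr_def discr_def)

text \<open>As a quadratic polynomial in cos 2a, the discriminant has the roots cos (2b + 2c) and
  cos (2b - 2c). Each of the two linear factors is a product of two sines.\<close>

lemma discr_cos_eq_sin_prod:
  "discr (cos (2*a)) (cos (2*b)) (cos (2*c)) =
     4 * sin (a + b + c) * sin (b + c - a) * sin (a + c - b) * sin (a + b - c)"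
proof -
  have 1: "2 * (sin (a + b + c) * sin (b + c - a)) = cos (2*a) - cos (2*b + 2*c)"
    using sin_times_sin[of "a + b + c" "b + c - a"] by (simp add: algebra_simps)
  have 2: "2 * (sin (a + c - b) * sin (a + b - c)) = cos (2*b - 2*c) - cos (2*a)"
    using sin_times_sin[of "a + c - b" "a + b - c"] cos_minus[of "2*b - 2*c"]
    by (simp add: algebra_simps)
  have sc: "sin (2*b) * sin (2*b) = 1 - cos (2*b) * cos (2*b)"
      "sin (2*c) * sin (2*c) = 1 - cos (2*c) * cos (2*c)"
    by (simp_all add: sin_squared_eq flip: power2_eq_square)
  have "4 * sin (a + b + c) * sin (b + c - a) * sin (a + c - b) * sin (a + b - c)
      = (2 * (sin (a + b + c) * sin (b + c - a))) * (2 * (sin (a + c - b) * sin (a + b - c)))"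
    by simp
  also have "\<dots> = (cos (2*a) - cos (2*b + 2*c)) * (cos (2*b - 2*c) - cos (2*a))"
    unfolding 1 2 ..
  also have "\<dots> = 2 * cos (2*a) * cos (2*b) * cos (2*c) - (cos (2*a))\<^sup>2
      - (cos (2*b))\<^sup>2 * (cos (2*c))\<^sup>2 + (sin (2*b) * sin (2*b)) * (sin (2*c) * sin (2*c))"
    unfolding cos_add cos_diff by (simp add: algebra_simps power2_eq_square)
  also have "\<dots> = discr (cos (2*a)) (cos (2*b)) (cos (2*c))"
    unfolding sc discr_def by (simp add: algebra_simps power2_eq_square)
  finally show ?thesis ..
qed

lemma trinoid_discr_eq:
  fixes w1 w2 w3 s :: real
  defines "a \<equiv> exponent_gap w1 s" and "b \<equiv> exponent_gap w2 s" and "c \<equiv> exponent_gap w3 s"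
  shows "trinoid_discr w1 w2 w3 s =
     4 * sin (pi * (a + b + c)) * sin (pi * (b + c - a)) * sin (pi * (a + c - b)) * sin (pi * (a + b - c))"
proof -
  have cos_abs: "cos (2 * pi * t) = cos (2 * (pi * \<bar>t\<bar>))" for t :: real
    by (cases "t \<ge> 0") (simp_all add: mult.assoc)
  show ?thesis
    unfolding trinoid_discr_def cos_abs discr_cos_eq_sin_prod a_def b_def c_def exponent_gap_def
    by (simp add: algebra_simps)
qed

section \<open>Growth and comparison of the exponents in s\<close>

lemma scaled_less_1:
  fixes w s :: real
  assumes "w < 1" "0 \<le> s" "s \<le> 1"
  shows "s * w < 1"
  using assms mult_left_le_one_le[of w s] mult_nonneg_nonpos[of s w] by (cases "w \<ge> 0") auto

text \<open>Rationalizing the numerator splits off the factor s; positivity and the slope at s = 0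
  can be read off from this form.\<close>

lemma exponent_gap_eq:
  assumes "w < 1" "0 \<le> s" "s \<le> 1"
  shows "exponent_gap w s = s * \<bar>w\<bar> / (2 * (1 + sqrt (1 - s * w)))"
proof -
  define q where "q = sqrt (1 - s * w)"
  have q: "q > 0" "q * q = 1 - s * w"
    using scaled_less_1[OF assms] by (simp_all add: q_def)
  have "nn (s * w) = s * w / (2 * (1 + q))"
    using q by (simp add: nn_def q_def[symmetric] field_simps)
  then show ?thesis using q assms by (simp add: exponent_gap_def q_def[symmetric] abs_mult)
qed

text \<open>The indicial equation nu (1 - nu) = s w / 4 in terms of |nu|, where nu has the sign of
  w. It replaces the square roots in the comparisons below.\<close>

lemma exponent_gap_quadratic:
  assumes "w < 1" "0 \<le> s" "s \<le> 1"
  shows "exponent_gap w s * (1 - sgn w * exponent_gap w s) = s * \<bar>w\<bar> / 4"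
proof -
  define q where "q = sqrt (1 - s * w)"
  have q: "q > 0" "q * q = 1 - s * w"
    using scaled_less_1[OF assms] by (simp_all add: q_def)
  have e: "exponent_gap w s = s * \<bar>w\<bar> / (2 * (1 + q))"
    using exponent_gap_eq[OF assms] by (simp add: q_def)
  have sw: "s * w = 1 - q * q" using q by simp
  have "sgn w * exponent_gap w s = s * w / (2 * (1 + q))"
    unfolding e by (simp add: sgn_mult_abs mult.left_commute[of "sgn w"])
  also have "\<dots> = (1 - q) / 2" unfolding sw using q by (simp add: field_simps)
  finally have f: "1 - sgn w * exponent_gap w s = (1 + q) / 2" by (simp add: field_simps)
  have "exponent_gap w s * (1 - sgn w * exponent_gap w s)
      = s * \<bar>w\<bar> / (2 * (1 + q)) * ((1 + q) / 2)" unfolding f unfolding e ..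
  also have "\<dots> = s * \<bar>w\<bar> / 4" using q by (simp add: field_simps)
  finally show ?thesis .
qed

lemma exponent_gap_pos:
  assumes "w < 1" "w \<noteq> 0" "0 < s" "s \<le> 1"
  shows "exponent_gap w s > 0"
proof -
  have "sqrt (1 - s * w) > 0" using scaled_less_1[of w s] assms by simp
  then show ?thesis using assms by (subst exponent_gap_eq) (auto intro!: divide_pos_pos add_pos_pos)
qed

lemma exponent_gap_less_half:
  assumes "0 < w" "w < 1" "0 \<le> s" "s \<le> 1"
  shows "exponent_gap w s < 1/2"
proof -
  have "0 \<le> s * w" "s * w < 1" using scaled_less_1[of w s] assms by auto
  then show ?thesis by (auto simp: exponent_gap_def nn_def)
qed

lemma exponent_gap_strict_mono:
  assumes "w < 1" "w \<noteq> 0" "0 \<le> s" "s < s'" "s' \<le> 1"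
  shows "exponent_gap w s < exponent_gap w s'"
proof (cases "w > 0")
  case True
  have "s * w < s' * w" using True assms by simp
  moreover have "s * w \<ge> 0" "s' * w \<ge> 0" "s' * w < 1" using True assms scaled_less_1[of w s'] by auto
  ultimately have "nn (s * w) < nn (s' * w)" "nn (s * w) \<ge> 0" "nn (s' * w) \<ge> 0"
    by (auto simp: nn_def real_sqrt_less_iff)
  then show ?thesis by (simp add: exponent_gap_def)
next
  case False
  then have "s * w > s' * w" using assms by (simp add: mult_less_cancel_right)
  moreover have "s * w \<le> 0" "s' * w \<le> 0" using False assms by (auto simp: mult_nonneg_nonpos)
  ultimately have "nn (s * w) > nn (s' * w)" "nn (s * w) \<le> 0" "nn (s' * w) \<le> 0"
    by (auto simp: nn_def real_sqrt_less_iff)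
  then show ?thesis by (simp add: exponent_gap_def)
qed

lemma continuous_on_exponent_gap: "continuous_on A (exponent_gap w)"
  unfolding exponent_gap_def nn_def by (intro continuous_intros) auto

lemma isCont_exponent_gap: "isCont (exponent_gap w) s"
  using continuous_on_exponent_gap[of UNIV w] by (simp add: continuous_on_eq_continuous_at)

text \<open>For u < 0 the gap a satisfies a (1 + a) = s |u| / 4, while b and c satisfy s |v| / 4
  \<le> b (1 + b) and s |w| / 4 \<le> c (1 + c) for either sign of v and w. As t (1 + t) is
  increasing and superadditive with surplus 2 b c, a \<ge> b + c would give |u| > |v| + |w|.\<close>

lemma exponent_gap_triangle_if_neg:
  assumes "u < 0" "v < 1" "v \<noteq> 0" "w < 1" "w \<noteq> 0" "\<bar>u\<bar> \<le> \<bar>v\<bar> + \<bar>w\<bar>" "0 < s" "s \<le> 1"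
  shows "exponent_gap u s < exponent_gap v s + exponent_gap w s"
proof (rule ccontr)
  define a b c where "a = exponent_gap u s" "b = exponent_gap v s" "c = exponent_gap w s"
  note abc = this
  assume "\<not> exponent_gap u s < exponent_gap v s + exponent_gap w s"
  then have le: "b + c \<le> a" by (simp add: abc)
  have pos: "b > 0" "c > 0" using exponent_gap_pos assms by (simp_all add: abc)
  have "s * \<bar>u\<bar> / 4 = a * (1 + a)"
    using exponent_gap_quadratic[of u s] assms by (simp add: abc)
  moreover have "a * (1 + a) \<ge> (b + c) * (1 + (b + c))"
    using le pos by (intro mult_mono) auto
  moreover have "s * \<bar>v\<bar> / 4 \<le> b * (1 + b)"
  proof -
    have "b * (1 - sgn v * b) \<le> b * (1 + b)"
      using pos by (intro mult_left_mono) (auto simp: sgn_if)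
    then show ?thesis using exponent_gap_quadratic[of v s] assms by (simp add: abc)
  qed
  moreover have "s * \<bar>w\<bar> / 4 \<le> c * (1 + c)"
  proof -
    have "c * (1 - sgn w * c) \<le> c * (1 + c)"
      using pos by (intro mult_left_mono) (auto simp: sgn_if)
    then show ?thesis using exponent_gap_quadratic[of w s] assms by (simp add: abc)
  qed
  moreover have "b * c > 0" using pos by simp
  moreover have "(b + c) * (1 + (b + c)) = b * (1 + b) + c * (1 + c) + 2 * (b * c)"
    by (simp add: algebra_simps)
  ultimately have "s * \<bar>u\<bar> > s * \<bar>v\<bar> + s * \<bar>w\<bar>" by linarith
  moreover have "s * \<bar>u\<bar> \<le> s * (\<bar>v\<bar> + \<bar>w\<bar>)" using assms by (intro mult_left_mono) auto
  ultimately show False by (simp add: algebra_simps)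
qed

text \<open>For u > 0 the larger gap also grows faster in proportion. Dividing the indicial
  equations at s' by those at s removes s, s' and the weights. If the ratio did not decrease, what
  remains would be (A - a) (a - e b) \<le> 0, although a < A and b < a.\<close>

lemma exponent_gap_ratio_decreasing:
  assumes "0 < u" "u < 1" "v < 1" "v \<noteq> 0" "0 < s" "s < s'" "s' \<le> 1"
    and less: "exponent_gap v s < exponent_gap u s"
  shows "exponent_gap v s' * exponent_gap u s < exponent_gap v s * exponent_gap u s'"
proof (rule ccontr)
  define a b where "a = exponent_gap u s" "b = exponent_gap v s"
  define A B where "A = exponent_gap u s'" "B = exponent_gap v s'"
  note ab = \<open>a = _\<close> \<open>b = _\<close> and AB = \<open>A = _\<close> \<open>B = _\<close>
  define e where "e = sgn v"
  have e: "e = 1 \<or> e = -1" using assms by (auto simp: e_def sgn_if)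
  assume "\<not> ?thesis"
  then have n: "b * A \<le> B * a" by (simp add: ab AB)
  have pos: "a > 0" "b > 0" "A > 0" "B > 0"
    using exponent_gap_pos assms by (simp_all add: ab AB)
  have aA: "a < A" using exponent_gap_strict_mono assms by (simp add: ab AB)
  have ba: "b < a" using less by (simp add: ab)
  have qa: "a * (1 - a) = s * u / 4" "A * (1 - A) = s' * u / 4"
    using exponent_gap_quadratic[of u s] exponent_gap_quadratic[of u s'] assms by (simp_all add: ab AB)
  have qb: "b * (1 - e * b) = s * \<bar>v\<bar> / 4" "B * (1 - e * B) = s' * \<bar>v\<bar> / 4"
    using exponent_gap_quadratic[of v s] exponent_gap_quadratic[of v s'] assms
    by (simp_all add: ab AB e_def)
  \<comment> \<open>Both sides equal s s' u |v| / 16.\<close>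
  have cross: "(A * (1 - A)) * (b * (1 - e * b)) = (a * (1 - a)) * (B * (1 - e * B))"
    unfolding qa qb by simp
  \<comment> \<open>The value that the smaller gap would have at s' if the ratio stayed constant.
    The next comparison uses that t (1 - e t) is increasing in the range at hand, which for e = 1
    ends at 1/2.\<close>
  define X where "X = b * A / a"
  have X: "X \<le> B" "X > 0" "X * a = b * A" using n pos by (simp_all add: X_def field_simps)
  have A2: "A < 1/2" using exponent_gap_less_half assms by (simp add: AB)
  have "X * (1 - e * X) \<le> B * (1 - e * B)"
  proof (cases "e = 1")
    case True
    then have "v > 0" using assms by (auto simp: e_def sgn_if split: if_splits)
    then have "B < 1/2" using exponent_gap_less_half assms by (simp add: AB)
    then have "(B - X) * (1 - B - X) \<ge> 0" using X by (intro mult_nonneg_nonneg) auto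
    then show ?thesis using True by (simp add: algebra_simps)
  next
    case False
    then show ?thesis using e X by (auto intro!: mult_mono)
  qed
  then have "a * (a * (1 - a)) * (X * (1 - e * X)) \<le> a * (a * (1 - a)) * (B * (1 - e * B))"
    using pos aA A2 by (intro mult_left_mono) auto
  also have "\<dots> = a * ((A * (1 - A)) * (b * (1 - e * b)))" unfolding cross by simp
  finally have "(1 - a) * (X * a) * (a - e * (X * a)) \<le> a * ((A * (1 - A)) * (b * (1 - e * b)))"
    by (simp add: algebra_simps)
  then have "(b * A) * ((1 - a) * (a - e * (b * A))) \<le> (b * A) * ((1 - A) * (a - e * (a * b)))"
    unfolding X by (simp add: algebra_simps)
  then have "(1 - a) * (a - e * (b * A)) \<le> (1 - A) * (a - e * (a * b))"
    using pos by (simp add: mult_le_cancel_left)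
  then have "(A - a) * (a - e * b) \<le> 0" by (simp add: algebra_simps)
  moreover have "(A - a) * (a - e * b) > 0" using e aA ba pos by (intro mult_pos_pos) auto
  ultimately show False by simp
qed

text \<open>At s the ratios of the two short sides to the long one add up to at most 1. Both are
  positive, hence each is below 1 and strictly decreases. Read backwards, this carries a triangle
  inequality from s = 1 to all smaller s.\<close>

lemma exponent_gap_triangle_fails_after:
  assumes "0 < u" "u < 1" "v < 1" "v \<noteq> 0" "w < 1" "w \<noteq> 0" "0 < s" "s < s'" "s' \<le> 1"
    and le: "exponent_gap v s + exponent_gap w s \<le> exponent_gap u s"
  shows "exponent_gap v s' + exponent_gap w s' < exponent_gap u s'"
proof -
  let ?m = exponent_gap
  have pos: "?m v s > 0" "?m w s > 0" "?m u s > 0" "?m u s' > 0" using exponent_gap_pos assms by simp_all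
  have "?m v s' * ?m u s < ?m v s * ?m u s'" "?m w s' * ?m u s < ?m w s * ?m u s'"
    using assms pos by (intro exponent_gap_ratio_decreasing; simp)+
  then have "(?m v s' + ?m w s') * ?m u s < (?m v s + ?m w s) * ?m u s'"
    by (simp add: algebra_simps)
  also have "\<dots> \<le> ?m u s * ?m u s'" using le pos by (intro mult_right_mono) auto
  finally show ?thesis using pos by (simp add: mult.commute)
qed

section \<open>Sign of the discriminant near the faces of the tetrahedron\<close>

lemma sin_pi_mult_pos: "0 < t \<Longrightarrow> t < 1 \<Longrightarrow> sin (pi * t) > 0"
  by (intro sin_gt_zero) auto

lemma sin_pi_mult_neg: "-1 < t \<Longrightarrow> t < 0 \<Longrightarrow> sin (pi * t) < 0"
  using sin_pi_mult_pos[of "-t"] by simp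

lemma trinoid_discr_pos:
  assumes "w1 < 1" "w1 \<noteq> 0" "w2 < 1" "w2 \<noteq> 0" "w3 < 1" "w3 \<noteq> 0"
    and ineqs: "trinoid_ineqs w1 w2 w3" and s: "0 < s" "s < 1"
  shows "trinoid_discr w1 w2 w3 s > 0"
proof -
  let ?m = exponent_gap
  have at1: "?m w 1 = \<bar>nn w\<bar>" for w by (simp add: exponent_gap_def)
  have tri: "?m u s < ?m v s + ?m w s"
    if "u < 1" "u \<noteq> 0" "v < 1" "v \<noteq> 0" "w < 1" "w \<noteq> 0" 
      "\<bar>u\<bar> \<le> \<bar>v\<bar> + \<bar>w\<bar>" "\<bar>nn u\<bar> \<le> \<bar>nn v\<bar> + \<bar>nn w\<bar>" for u v w
  proof (cases "u < 0")
    case True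
    then show ?thesis using that s by (intro exponent_gap_triangle_if_neg) auto
  next
    case False
    then show ?thesis
      using that s exponent_gap_triangle_fails_after[of u v w s 1] by (force simp: at1)
  qed
  have t: "?m w1 s < ?m w2 s + ?m w3 s" "?m w2 s < ?m w1 s + ?m w3 s" "?m w3 s < ?m w1 s + ?m w2 s"
    using assms by (intro tri; simp add: trinoid_ineqs_def add.commute)+
  have pos: "?m w1 s > 0" "?m w2 s > 0" "?m w3 s > 0" using exponent_gap_pos assms by simp_all
  have "?m w1 s < ?m w1 1" "?m w2 s < ?m w2 1" "?m w3 s < ?m w3 1"
    using exponent_gap_strict_mono assms by simp_all
  then have "?m w1 s + ?m w2 s + ?m w3 s < 1" using ineqs unfolding at1 trinoid_ineqs_def by linarith
  then show ?thesis
    using t pos unfolding trinoid_discr_eq by (intro mult_pos_pos sin_pi_mult_pos) auto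
qed

text \<open>If the first gap is at least the sum of the other two, both other alternating sums are
  positive; with a total below 1, only one of the four sines can then be nonpositive.\<close>

lemma trinoid_discr_pos_imp_triangle:
  assumes w: "w1 < 1" "w1 \<noteq> 0" "w2 < 1" "w2 \<noteq> 0" "w3 < 1" "w3 \<noteq> 0"
    and s: "0 < s" "s \<le> 1" and D: "trinoid_discr w1 w2 w3 s > 0"
    and sum: "exponent_gap w1 s + exponent_gap w2 s + exponent_gap w3 s < 1"
  shows "exponent_gap w1 s < exponent_gap w2 s + exponent_gap w3 s"
proof (rule ccontr)
  assume *: "\<not> ?thesis"
  let ?m = exponent_gap
  have pos: "?m w1 s > 0" "?m w2 s > 0" "?m w3 s > 0" using exponent_gap_pos assms by simp_all
  have "sin (pi * (?m w2 s + ?m w3 s - ?m w1 s)) \<le> 0"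
    using * pos sum sin_pi_mult_neg[of "?m w2 s + ?m w3 s - ?m w1 s"]
    by (cases "?m w2 s + ?m w3 s = ?m w1 s") auto
  moreover have "sin (pi * (?m w1 s + ?m w2 s + ?m w3 s)) > 0"
      "sin (pi * (?m w1 s + ?m w3 s - ?m w2 s)) > 0" "sin (pi * (?m w1 s + ?m w2 s - ?m w3 s)) > 0"
    using * pos sum by (auto intro!: sin_pi_mult_pos)
  ultimately have "trinoid_discr w1 w2 w3 s \<le> 0"
    unfolding trinoid_discr_eq
    by (intro mult_nonpos_nonneg mult_nonneg_nonpos[of "4 * _"]) simp_all
  then show False using D by simp
qed

text \<open>Exactly one sine is negative in either alternative: the first describes points just
  beyond the face a = b + c, the second points just beyond the face a + b + c = 1.\<close>

lemma trinoid_discr_neg_if: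
  fixes w1 w2 w3 s :: real
  defines "a \<equiv> exponent_gap w1 s" and "b \<equiv> exponent_gap w2 s" and "c \<equiv> exponent_gap w3 s"
  assumes "0 < a + c - b" "a + c - b < 1" "0 < a + b - c" "a + b - c < 1"
    and "(0 < a + b + c \<and> a + b + c < 1 \<and> -1 < b + c - a \<and> b + c - a < 0) \<or>
         (1 < a + b + c \<and> a + b + c < 2 \<and> 0 < b + c - a \<and> b + c - a < 1)"
  shows "trinoid_discr w1 w2 w3 s < 0"
proof -
  have "sin (pi * (a + b + c)) * sin (pi * (b + c - a)) < 0"
    using assms(8)
  proof
    assume "1 < a + b + c \<and> a + b + c < 2 \<and> 0 < b + c - a \<and> b + c - a < 1"
    moreover then have "sin (pi * (a + b + c - 1)) > 0" by (intro sin_pi_mult_pos) auto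
    then have "sin (pi * (a + b + c)) < 0" by (simp add: algebra_simps sin_diff)
    ultimately show ?thesis by (intro mult_neg_pos sin_pi_mult_pos) auto
  qed (intro mult_pos_neg sin_pi_mult_pos sin_pi_mult_neg; simp)
  moreover have "sin (pi * (a + c - b)) * sin (pi * (a + b - c)) > 0"
    using assms by (intro mult_pos_pos sin_pi_mult_pos) auto
  ultimately have "(sin (pi * (a + b + c)) * sin (pi * (b + c - a))) * (sin (pi * (a + c - b)) * sin (pi * (a + b - c))) < 0"
    by (rule mult_neg_pos)
  then show ?thesis unfolding trinoid_discr_eq a_def b_def c_def
    by (simp add: mult_ac)
qed

lemma eventually_at_right_notin_finite:
  fixes x :: real
  assumes "finite Z"
  shows "eventually (\<lambda>s. s \<notin> Z) (at_right x)"
  using islimpt_finite[OF assms, of x] unfolding islimpt_iff_eventually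
  by (auto simp: eventually_at_filter elim: eventually_mono)

text \<open>The slope at s = 0, through which inequalities between the gaps pass to the
  weights.\<close>

lemma exponent_gap_div_tendsto:
  assumes "w < 1"
  shows "((\<lambda>s. exponent_gap w s / s) \<longlongrightarrow> \<bar>w\<bar> / 4) (at_right 0)"
proof (rule Lim_transform_eventually)
  have "((\<lambda>s. \<bar>w\<bar> / (2 * (1 + sqrt (1 - s * w)))) \<longlongrightarrow> \<bar>w\<bar> / (2 * (1 + sqrt (1 - 0 * w)))) (at_right 0)"
    by (intro tendsto_intros) auto
  then show "((\<lambda>s. \<bar>w\<bar> / (2 * (1 + sqrt (1 - s * w)))) \<longlongrightarrow> \<bar>w\<bar> / 4) (at_right 0)" by simp
  have "eventually (\<lambda>s. s \<in> {0<..<1}) (at_right (0::real))"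
    by (intro eventually_at_right_real) auto
  then show "eventually (\<lambda>s. \<bar>w\<bar> / (2 * (1 + sqrt (1 - s * w))) = exponent_gap w s / s) (at_right 0)"
    by eventually_elim (simp add: exponent_gap_eq assms)
qed

lemma tendsto_at_right_exponent_gap: "(exponent_gap w \<longlongrightarrow> exponent_gap w s) (at_right s)"
  using isCont_exponent_gap[where w = w and s = s] by (simp add: isCont_def filterlim_at_split)

text \<open>Equality forces w1 > 0 by \<open>exponent_gap_triangle_if_neg\<close>, so the first gap
  is below 1/2 and the sum, which is twice this gap, stays away from 1. Right after s the point lies
  strictly beyond the face by \<open>exponent_gap_triangle_fails_after\<close>.\<close>

lemma eventually_trinoid_discr_neg_triangle:
  assumes w: "w1 < 1" "w1 \<noteq> 0" "w2 < 1" "w2 \<noteq> 0" "w3 < 1" "w3 \<noteq> 0"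
    and s: "0 < s" "s < 1" and w1: "\<bar>w1\<bar> \<le> \<bar>w2\<bar> + \<bar>w3\<bar>"
    and eq: "exponent_gap w1 s = exponent_gap w2 s + exponent_gap w3 s"
  shows "eventually (\<lambda>s'. trinoid_discr w1 w2 w3 s' < 0) (at_right s)"
    and "exponent_gap w1 s + exponent_gap w2 s + exponent_gap w3 s < 1"
proof -
  let ?m = exponent_gap
  have "\<not> w1 < 0" using exponent_gap_triangle_if_neg[of w1 w2 w3 s] assms by auto
  then have w1p: "w1 > 0" using w by simp
  have pos: "?m w1 s > 0" "?m w2 s > 0" "?m w3 s > 0" using w s by (intro exponent_gap_pos; simp)+
  have half: "?m w1 s < 1/2" using w1p w s by (intro exponent_gap_less_half) auto
  then show sum: "?m w1 s + ?m w2 s + ?m w3 s < 1" using eq by simp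
  have ev: "eventually (\<lambda>s'. s' \<in> {s<..<1}) (at_right s)"
    using s by (intro eventually_at_right_real) auto
  have t1: "((\<lambda>s. ?m w1 s + ?m w2 s + ?m w3 s) \<longlongrightarrow> ?m w1 s + ?m w2 s + ?m w3 s) (at_right s)"
    and t2: "((\<lambda>s. ?m w1 s + ?m w3 s - ?m w2 s) \<longlongrightarrow> ?m w1 s + ?m w3 s - ?m w2 s) (at_right s)"
    and t3: "((\<lambda>s. ?m w1 s + ?m w2 s - ?m w3 s) \<longlongrightarrow> ?m w1 s + ?m w2 s - ?m w3 s) (at_right s)"
    by (intro tendsto_intros tendsto_at_right_exponent_gap)+
  have "eventually (\<lambda>s'. ?m w1 s' + ?m w2 s' + ?m w3 s' < 1) (at_right s)"
    by (rule order_tendstoD(2)[OF t1 sum])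
  moreover have "eventually (\<lambda>s'. 0 < ?m w1 s' + ?m w3 s' - ?m w2 s') (at_right s)"
    using pos eq by (intro order_tendstoD(1)[OF t2]) simp
  moreover have "eventually (\<lambda>s'. 0 < ?m w1 s' + ?m w2 s' - ?m w3 s') (at_right s)"
    using pos eq by (intro order_tendstoD(1)[OF t3]) simp
  ultimately show "eventually (\<lambda>s'. trinoid_discr w1 w2 w3 s' < 0) (at_right s)"
    using ev
  proof eventually_elim
    case (elim s')
    have p: "?m w1 s' > 0" "?m w2 s' > 0" "?m w3 s' > 0"
      using exponent_gap_pos w s elim by simp_all
    have "?m w2 s' + ?m w3 s' < ?m w1 s'"
      using w w1p s elim eq by (intro exponent_gap_triangle_fails_after[of w1 w2 w3 s s']) auto
    then show ?case using elim p by (intro trinoid_discr_neg_if) auto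
  qed
qed

text \<open>All gaps increase strictly, so their sum exceeds 1 right after s, while by continuity
  the other three sines remain positive.\<close>

lemma eventually_trinoid_discr_neg_sum:
  assumes w: "w1 < 1" "w1 \<noteq> 0" "w2 < 1" "w2 \<noteq> 0" "w3 < 1" "w3 \<noteq> 0"
    and s: "0 < s" "s < 1"
    and eq: "exponent_gap w1 s + exponent_gap w2 s + exponent_gap w3 s = 1"
    and tri: "exponent_gap w1 s < exponent_gap w2 s + exponent_gap w3 s"
      "exponent_gap w2 s < exponent_gap w1 s + exponent_gap w3 s"
      "exponent_gap w3 s < exponent_gap w1 s + exponent_gap w2 s"
  shows "eventually (\<lambda>s'. trinoid_discr w1 w2 w3 s' < 0) (at_right s)"
proof -
  let ?m = exponent_gap
  have pos: "?m w1 s > 0" "?m w2 s > 0" "?m w3 s > 0" using exponent_gap_pos assms by simp_all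
  have ev: "eventually (\<lambda>s'. s' \<in> {s<..<1}) (at_right s)"
    using s by (intro eventually_at_right_real) auto
  have t1: "((\<lambda>s. ?m w1 s + ?m w2 s + ?m w3 s) \<longlongrightarrow> ?m w1 s + ?m w2 s + ?m w3 s) (at_right s)"
    and t2: "((\<lambda>s. ?m w1 s + ?m w3 s - ?m w2 s) \<longlongrightarrow> ?m w1 s + ?m w3 s - ?m w2 s) (at_right s)"
    and t3: "((\<lambda>s. ?m w1 s + ?m w2 s - ?m w3 s) \<longlongrightarrow> ?m w1 s + ?m w2 s - ?m w3 s) (at_right s)"
    and t4: "((\<lambda>s. ?m w2 s + ?m w3 s - ?m w1 s) \<longlongrightarrow> ?m w2 s + ?m w3 s - ?m w1 s) (at_right s)"
    by (intro tendsto_intros tendsto_at_right_exponent_gap)+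
  have "eventually (\<lambda>s'. ?m w1 s' + ?m w2 s' + ?m w3 s' < 2) (at_right s)"
    using eq by (intro order_tendstoD(2)[OF t1]) simp
  moreover have "eventually (\<lambda>s'. 0 < ?m w1 s' + ?m w3 s' - ?m w2 s') (at_right s)"
    using tri by (intro order_tendstoD(1)[OF t2]) simp
  moreover have "eventually (\<lambda>s'. 0 < ?m w1 s' + ?m w2 s' - ?m w3 s') (at_right s)"
    using tri by (intro order_tendstoD(1)[OF t3]) simp
  moreover have "eventually (\<lambda>s'. 0 < ?m w2 s' + ?m w3 s' - ?m w1 s') (at_right s)"
    using tri by (intro order_tendstoD(1)[OF t4]) simp
  moreover have "eventually (\<lambda>s'. ?m w1 s' + ?m w3 s' - ?m w2 s' < 1) (at_right s)"
    using pos eq by (intro order_tendstoD(2)[OF t2]) simp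
  moreover have "eventually (\<lambda>s'. ?m w1 s' + ?m w2 s' - ?m w3 s' < 1) (at_right s)"
    using pos eq by (intro order_tendstoD(2)[OF t3]) simp
  moreover have "eventually (\<lambda>s'. ?m w2 s' + ?m w3 s' - ?m w1 s' < 1) (at_right s)"
    using pos eq by (intro order_tendstoD(2)[OF t4]) simp
  ultimately show ?thesis using ev
  proof eventually_elim
    case (elim s')
    have "?m w1 s < ?m w1 s'" "?m w2 s < ?m w2 s'" "?m w3 s < ?m w3 s'"
      using elim w s by (auto intro!: exponent_gap_strict_mono)
    then show ?case using elim eq by (intro trinoid_discr_neg_if) auto
  qed
qed

text \<open>The point of exponent gaps starts at the vertex 0 of a tetrahedron inside which the discriminant
  is positive; a path that leaves the tetrahedron crosses one of its faces away from the edges,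
  which makes the discriminant negative.\<close>
lemma trinoid_ineqs_if_discr_pos:
  assumes w: "w1 < 1" "w1 \<noteq> 0" "w2 < 1" "w2 \<noteq> 0" "w3 < 1" "w3 \<noteq> 0"
    and Z: "finite Z" and D: "\<And>s. 0 < s \<Longrightarrow> s < 1 \<Longrightarrow> s \<notin> Z \<Longrightarrow> trinoid_discr w1 w2 w3 s > 0"
  shows "trinoid_ineqs w1 w2 w3"
proof -
  let ?m = exponent_gap
  have ev01: "eventually (\<lambda>s. s \<in> {x<..<1}) (at_right x)" if "x < 1" for x :: real
    using that by (intro eventually_at_right_real) auto
  have evD: "eventually (\<lambda>s. trinoid_discr w1 w2 w3 s > 0) (at_right x)" if "0 \<le> x" "x < 1" for x
    using ev01[OF that(2)] eventually_at_right_notin_finite[OF Z, of x]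
    by eventually_elim (use that D in auto)
  have t0: "((\<lambda>s. ?m w1 s + ?m w2 s + ?m w3 s) \<longlongrightarrow> ?m w1 0 + ?m w2 0 + ?m w3 0) (at_right 0)"
    by (intro tendsto_intros tendsto_at_right_exponent_gap)
  have m0: "?m w 0 = 0" for w by (simp add: exponent_gap_def nn_def)
  have sum0: "eventually (\<lambda>s. ?m w1 s + ?m w2 s + ?m w3 s < 1) (at_right 0)"
    using order_tendstoD(2)[OF t0, of 1] by (simp add: m0)
  \<comment> \<open>Near s = 0 the sum of the gaps is below 1, so a positive discriminant forces all
    triangle inequalities. Division by s and s \<rightarrow> 0 then give those of the
    weights.\<close>
  have small: "eventually (\<lambda>s. ?m w1 s + ?m w2 s + ?m w3 s < 1 \<and> ?m w1 s < ?m w2 s + ?m w3 s \<and>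
      ?m w2 s < ?m w1 s + ?m w3 s \<and> ?m w3 s < ?m w2 s + ?m w1 s \<and> s \<in> {0<..<1}) (at_right 0)"
    using sum0 ev01[of 0, simplified] evD[of 0, simplified]
  proof eventually_elim
    case (elim s)
    then show ?case
      using w trinoid_discr_pos_imp_triangle[of w1 w2 w3 s]
        trinoid_discr_pos_imp_triangle[of w2 w1 w3 s, folded trinoid_discr_commute(1)]
        trinoid_discr_pos_imp_triangle[of w3 w2 w1 s, folded trinoid_discr_commute(2)]
      by (simp add: add_ac)
  qed
  have wtri: "\<bar>u\<bar> \<le> \<bar>v\<bar> + \<bar>w\<bar>" if "u < 1" "v < 1" "w < 1"
    and lt: "eventually (\<lambda>s. ?m u s < ?m v s + ?m w s \<and> s \<in> {0<..<1}) (at_right 0)" for u v w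
  proof -
    have "\<bar>u\<bar> / 4 \<le> \<bar>v\<bar> / 4 + \<bar>w\<bar> / 4"
    proof (rule tendsto_le)
      show "((\<lambda>s. ?m v s / s + ?m w s / s) \<longlongrightarrow> \<bar>v\<bar> / 4 + \<bar>w\<bar> / 4) (at_right 0)"
        using that by (intro tendsto_intros exponent_gap_div_tendsto)
      show "((\<lambda>s. ?m u s / s) \<longlongrightarrow> \<bar>u\<bar> / 4) (at_right 0)"
        using that by (intro exponent_gap_div_tendsto)
      show "eventually (\<lambda>s. ?m u s / s \<le> ?m v s / s + ?m w s / s) (at_right 0)"
        using lt by eventually_elim (simp add: field_simps)
    qed simp
    then show ?thesis by simp
  qed
  have wt: "\<bar>w1\<bar> \<le> \<bar>w2\<bar> + \<bar>w3\<bar>" "\<bar>w2\<bar> \<le> \<bar>w1\<bar> + \<bar>w3\<bar>" "\<bar>w3\<bar> \<le> \<bar>w2\<bar> + \<bar>w1\<bar>"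
    using w small by (auto intro!: wtri elim: eventually_mono)
  \<comment> \<open>The minimum of the four linear forms of the faces: it is nonnegative on the
    closed tetrahedron and zero on its boundary.\<close>
  define e where "e s = min (1 - (?m w1 s + ?m w2 s + ?m w3 s)) (min (?m w2 s + ?m w3 s - ?m w1 s)
      (min (?m w1 s + ?m w3 s - ?m w2 s) (?m w2 s + ?m w1 s - ?m w3 s)))" for s
  have "e 1 \<ge> 0"
  proof (rule ccontr)
    assume "\<not> e 1 \<ge> 0"
    then have e1: "e 1 < 0" by simp
    have "\<exists>s0. e s0 > 0 \<and> s0 \<in> {0<..<1}"
      using eventually_happens[OF small] by (auto simp: e_def)
    then obtain s0 where s0: "e s0 > 0" "0 < s0" "s0 < 1" by auto
    have "continuous_on {s0..1} e"
      unfolding e_def by (intro continuous_intros continuous_on_exponent_gap)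
    \<comment> \<open>Any zero of \<open>e\<close> will do, since only the behaviour immediately to
      its right enters.\<close>
    then obtain s where s: "s0 \<le> s" "s \<le> 1" "e s = 0"
      using IVT2'[of e 1 0 s0] s0 e1 by auto
    then have s01: "0 < s" "s < 1" using s0 e1 by (auto simp: order_le_less)
    have ge: "?m w1 s + ?m w2 s + ?m w3 s \<le> 1" "?m w1 s \<le> ?m w2 s + ?m w3 s"
        "?m w2 s \<le> ?m w1 s + ?m w3 s" "?m w3 s \<le> ?m w2 s + ?m w1 s"
      using s(3) unfolding e_def by linarith+
    have "eventually (\<lambda>s'. trinoid_discr w1 w2 w3 s' < 0) (at_right s)"
    proof -
      consider "?m w1 s = ?m w2 s + ?m w3 s" | "?m w2 s = ?m w1 s + ?m w3 s" 
        | "?m w3 s = ?m w2 s + ?m w1 s" | "?m w1 s < ?m w2 s + ?m w3 s"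
          "?m w2 s < ?m w1 s + ?m w3 s" "?m w3 s < ?m w2 s + ?m w1 s" "?m w1 s + ?m w2 s + ?m w3 s = 1"
        using ge s(3) unfolding e_def by linarith
      then show ?thesis
      proof cases
        case 1
        then show ?thesis using w s01 wt by (intro eventually_trinoid_discr_neg_triangle)
      next
        case 2
        then show ?thesis using w s01 wt unfolding trinoid_discr_commute(1)[of w1]
          by (intro eventually_trinoid_discr_neg_triangle)
      next
        case 3
        then show ?thesis using w s01 wt unfolding trinoid_discr_commute(2)[of w1]
          by (intro eventually_trinoid_discr_neg_triangle)
      next
        case 4
        then show ?thesis using w s01 by (intro eventually_trinoid_discr_neg_sum) (auto simp: add.commute)
      qed
    qed
    moreover have "eventually (\<lambda>s'. trinoid_discr w1 w2 w3 s' > 0) (at_right s)"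
      using s01 by (intro evD) auto
    ultimately have "eventually (\<lambda>s'. False) (at_right s)" by eventually_elim simp
    then show False by simp
  qed
  then show ?thesis using wt
    by (auto simp: e_def trinoid_ineqs_def exponent_gap_def)
qed

section \<open>Transport along paths\<close>

text \<open>Integrating the derivatives tolerates the finite set K, which contains the corners of
  piecewise smooth paths.\<close>

lemma norm_diff_le_if_derivative_le:
  fixes f :: "real \<Rightarrow> 'a::banach" and \<phi> :: "real \<Rightarrow> real"
  assumes K: "finite K" and ab: "a \<le> b"
    and f: "continuous_on {a..b} f" "\<And>x. x \<in> {a..b} - K \<Longrightarrow> (f has_vector_derivative f' x) (at x)"
    and \<phi>: "continuous_on {a..b} \<phi>" "\<And>x. x \<in> {a..b} - K \<Longrightarrow> (\<phi> has_real_derivative \<phi>' x) (at x)"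
    and le: "\<And>x. x \<in> {a..b} - K \<Longrightarrow> norm (f' x) \<le> \<phi>' x"
  shows "norm (f b - f a) \<le> \<phi> b - \<phi> a"
proof -
  have 1: "((\<lambda>x. if x \<in> K then 0 else f' x) has_integral (f b - f a)) {a..b}"
    by (rule fundamental_theorem_of_calculus_strong[OF K ab]) (use f in auto)
  have 2: "((\<lambda>x. if x \<in> K then 0 else \<phi>' x) has_integral (\<phi> b - \<phi> a)) {a..b}"
    by (rule fundamental_theorem_of_calculus_strong[OF K ab])
      (use \<phi> in \<open>auto simp: has_real_derivative_iff_has_vector_derivative\<close>)
  have "norm (integral {a..b} (\<lambda>x. if x \<in> K then 0 else f' x))
      \<le> integral {a..b} (\<lambda>x. if x \<in> K then 0 else \<phi>' x)"
    using 1 2 le by (intro integral_norm_bound_integral) (auto intro: has_integral_integrable)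
  then show ?thesis using 1 2 by (simp add: integral_unique)
qed

text \<open>The squared norm times exp (- 2 C (x - a)) does not increase. The square is taken
  because the norm itself need not be differentiable at zeros of f.\<close>

lemma gronwall:
  fixes f :: "real \<Rightarrow> 'a::{real_inner, banach}"
  assumes K: "finite K" and ab: "a \<le> b"
    and f: "continuous_on {a..b} f" "\<And>x. x \<in> {a..b} - K \<Longrightarrow> (f has_vector_derivative f' x) (at x)"
    and le: "\<And>x. x \<in> {a..b} - K \<Longrightarrow> norm (f' x) \<le> C * norm (f x)"
  shows "norm (f b) \<le> norm (f a) * exp (C * (b - a))"
proof -
  define g where "g x = (f x \<bullet> f x) * exp (- (2 * C * (x - a)))" for x
  define g' where "g' x = (2 * (f x \<bullet> f' x) - 2 * C * (f x \<bullet> f x)) * exp (- (2 * C * (x - a)))" for x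
  have "continuous_on {a..b} g" unfolding g_def using f(1) by (intro continuous_intros)
  moreover have "(g has_real_derivative g' x) (at x)" if "x \<in> {a..b} - K" for x
    unfolding g_def g'_def has_real_derivative_iff_has_vector_derivative
    using f(2)[OF that] unfolding has_vector_derivative_def
    by (auto intro!: derivative_eq_intros simp: algebra_simps inner_commute)
  moreover have g'_le: "g' x \<le> 0" if "x \<in> {a..b} - K" for x
  proof -
    have "f x \<bullet> f' x \<le> norm (f x) * norm (f' x)" by (rule norm_cauchy_schwarz)
    also have "\<dots> \<le> norm (f x) * (C * norm (f x))" using le[OF that] by (intro mult_left_mono) auto
    also have "\<dots> = C * (f x \<bullet> f x)" by (simp add: dot_square_norm power2_eq_square)
    finally show ?thesis unfolding g'_def by (simp add: mult_nonpos_nonneg)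
  qed
  ultimately have "((\<lambda>x. if x \<in> K then 0 else g' x) has_integral (g b - g a)) {a..b}"
    by (intro fundamental_theorem_of_calculus_strong[OF K ab])
      (auto simp: has_real_derivative_iff_has_vector_derivative)
  then have "g b - g a \<le> 0"
    by (rule has_integral_le[OF _ has_integral_0, of _ _ "{a..b}"]) (use g'_le in auto)
  then have "(norm (f b))\<^sup>2 * exp (- (2 * C * (b - a))) \<le> (norm (f a))\<^sup>2"
    by (simp add: g_def dot_square_norm)
  moreover have le_exp: "p * exp (- u) \<le> q \<Longrightarrow> p \<le> q * exp u" for p q u :: real
    by (simp add: exp_minus field_simps)
  ultimately have "(norm (f b))\<^sup>2 \<le> (norm (f a))\<^sup>2 * exp (2 * C * (b - a))"
    using le_exp by blast
  also have "\<dots> = (norm (f a) * exp (C * (b - a)))\<^sup>2"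
    by (simp add: power_mult_distrib mult_ac flip: exp_double)
  finally show ?thesis by (rule power2_le_imp_le) simp
qed

text \<open>The growth bound for f is inserted into the bound for f', which is then integrated; the
  result is small together with C.\<close>

lemma gronwall_deviation:
  fixes f :: "real \<Rightarrow> 'a::{real_inner, banach}"
  assumes K: "finite K" and ab: "a \<le> b" and C: "C \<ge> 0"
    and f: "continuous_on {a..b} f" "\<And>x. x \<in> {a..b} - K \<Longrightarrow> (f has_vector_derivative f' x) (at x)"
    and le: "\<And>x. x \<in> {a..b} - K \<Longrightarrow> norm (f' x) \<le> C * norm (f x)"
  shows "norm (f b - f a) \<le> C * (b - a) * exp (C * (b - a)) * norm (f a)"
proof -
  let ?B = "C * (norm (f a) * exp (C * (b - a)))"
  have "norm (f' x) \<le> ?B" if "x \<in> {a..b} - K" for x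
  proof -
    have "norm (f x) \<le> norm (f a) * exp (C * (x - a))"
      by (rule gronwall[OF K, where f' = f']) (use that f le in \<open>auto intro: continuous_on_subset\<close>)
    also have "\<dots> \<le> norm (f a) * exp (C * (b - a))"
      using that C by (intro mult_left_mono) (auto intro!: mult_left_mono)
    finally show ?thesis using le[OF that] C by (meson mult_left_mono order_trans)
  qed
  then have "norm (f b - f a) \<le> ?B * b - ?B * a"
    using f ab by (intro norm_diff_le_if_derivative_le[OF K, where \<phi>' = "\<lambda>_. ?B"])
      (auto intro!: continuous_intros derivative_eq_intros)
  then show ?thesis by (simp add: algebra_simps)
qed

section \<open>Entrywise calculus for matrix-valued functions\<close>

lemma has_vector_derivative_vec:
  fixes f :: "real \<Rightarrow> 'a::real_normed_vector^'n"
  assumes "\<And>i. ((\<lambda>x. f x $ i) has_vector_derivative f' $ i) (at x within S)"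
  shows "(f has_vector_derivative f') (at x within S)"
  unfolding has_vector_derivative_def has_derivative_def
proof (intro conjI bounded_linear_scaleR_left vec_tendstoI)
  fix i
  show "((\<lambda>y. ((f y - f (Lim (at x within S) (\<lambda>x. x)) - (y - Lim (at x within S) (\<lambda>x. x)) *\<^sub>R f') /\<^sub>R
      norm (y - Lim (at x within S) (\<lambda>x. x))) $ i) \<longlongrightarrow> 0 $ i) (at x within S)"
    using assms[of i] unfolding has_vector_derivative_def has_derivative_def by simp
qed

lemma has_vector_derivative_mat:
  fixes f :: "real \<Rightarrow> 'a::real_normed_vector^'n^'m"
  assumes "\<And>i j. ((\<lambda>x. f x $ i $ j) has_vector_derivative f' $ i $ j) (at x within S)"
  shows "(f has_vector_derivative f') (at x within S)"
  by (intro has_vector_derivative_vec assms)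

lemma norm_mat2_nth_le: "norm (M $ i $ j) \<le> norm (M :: cmat2)"
  by (rule order_trans[OF Finite_Cartesian_Product.norm_nth_le Finite_Cartesian_Product.norm_nth_le])

lemma continuous_on_mat:
  fixes f :: "'a::topological_space \<Rightarrow> 'b::topological_space^'n^'m"
  assumes "\<And>i j. continuous_on S (\<lambda>x. f x $ i $ j)"
  shows "continuous_on S f"
  using assms unfolding continuous_on_def by (auto intro!: vec_tendstoI)

lemma bounded_bilinear_matrix_mult:
  "bounded_bilinear ((**) :: cmat2 \<Rightarrow> cmat2 \<Rightarrow> cmat2)"
proof -
  have "bilinear ((**) :: cmat2 \<Rightarrow> cmat2 \<Rightarrow> cmat2)"
    unfolding bilinear_def by (auto intro!: linearI simp: mat2_simps algebra_simps)
  then show ?thesis by (simp add: bilinear_conv_bounded_bilinear)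
qed

lemma bounded_linear_adj2: "bounded_linear (adj2 :: cmat2 \<Rightarrow> cmat2)"
  by (subst linear_conv_bounded_linear[symmetric])
    (auto intro!: linearI simp: mat2_simps adj2_nth)

text \<open>\<open>sol_along\<close> on an arbitrary parameter interval, which allows cutting and
  joining. The derivatives are two-sided; the endpoints can be put into the exceptional set
  K.\<close>

definition sol_on :: "(complex \<Rightarrow> cmat2) \<Rightarrow> (real \<Rightarrow> complex) \<Rightarrow> real \<Rightarrow> real \<Rightarrow> (real \<Rightarrow> cmat2) \<Rightarrow> bool" where
  "sol_on A g a b Y \<longleftrightarrow>
     continuous_on {a..b} Y \<and>
     (\<exists>K. finite K \<and> (\<forall>t\<in>{a..b} - K.
        (Y has_vector_derivative
           (Y t ** (\<chi> i j. A (g t) $ i $ j * vector_derivative g (at t)))) (at t)))"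

lemma sol_onI:
  assumes "continuous_on {a..b} Y" "finite K"
    and "\<And>t. t \<in> {a..b} - K \<Longrightarrow> (Y has_vector_derivative
           (Y t ** (\<chi> i j. A (g t) $ i $ j * vector_derivative g (at t)))) (at t)"
  shows "sol_on A g a b Y"
  unfolding sol_on_def using assms by (intro conjI exI[of _ K] ballI)

lemma sol_along_iff_sol_on: "sol_along A g X Y \<longleftrightarrow> sol_on A g 0 1 Y \<and> Y 0 = X"
proof
  assume L: "sol_along A g X Y"
  then obtain K where K: "finite K" "\<And>t. t \<in> {0..1} - K \<Longrightarrow> (Y has_vector_derivative
       (Y t ** (\<chi> i j. A (g t) $ i $ j * vector_derivative g (at t)))) (at t within {0..1})"
    unfolding sol_along_def by blast
  have "(Y has_vector_derivative
       (Y t ** (\<chi> i j. A (g t) $ i $ j * vector_derivative g (at t)))) (at t)"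
    if "t \<in> {0..1} - (K \<union> {0, 1})" for t
    using K(2)[of t] that by (simp add: at_within_Icc_at)
  moreover have "finite (K \<union> {0, 1})" using K by simp
  ultimately show "sol_on A g 0 1 Y \<and> Y 0 = X"
    using L unfolding sol_on_def sol_along_def by blast
next
  assume "sol_on A g 0 1 Y \<and> Y 0 = X"
  then show "sol_along A g X Y"
    unfolding sol_on_def sol_along_def by (meson has_vector_derivative_at_within)
qed

lemma sol_on_subset:
  assumes "sol_on A g a b Y" "a \<le> c" "d \<le> b"
  shows "sol_on A g c d Y"
proof -
  obtain K where K: "continuous_on {a..b} Y" "finite K" "\<forall>t\<in>{a..b} - K. (Y has_vector_derivative
       (Y t ** (\<chi> i j. A (g t) $ i $ j * vector_derivative g (at t)))) (at t)"
    using assms(1) unfolding sol_on_def by (elim conjE exE)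
  have sub: "{c..d} \<subseteq> {a..b}" using assms by auto
  show ?thesis
  proof (rule sol_onI)
    show "continuous_on {c..d} Y" using K(1) sub by (rule continuous_on_subset)
    show "(Y has_vector_derivative
        (Y t ** (\<chi> i j. A (g t) $ i $ j * vector_derivative g (at t)))) (at t)"
      if "t \<in> {c..d} - K" for t
      using K(3) that sub by (intro bspec[OF K(3)]) auto
  qed (rule K(2))
qed

lemma sol_on_join:
  assumes ab: "a \<le> b" "b \<le> c" and Y1: "sol_on A g a b Y1" and Y2: "sol_on A g b c Y2"
    and eq: "Y1 b = Y2 b"
  shows "sol_on A g a c (\<lambda>t. if t \<le> b then Y1 t else Y2 t)"
proof -
  let ?Y = "\<lambda>t. if t \<le> b then Y1 t else Y2 t"
  let ?B = "\<lambda>t. (\<chi> i j. A (g t) $ i $ j * vector_derivative g (at t))"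
  obtain K1 where K1: "finite K1" "\<forall>t\<in>{a..b} - K1. (Y1 has_vector_derivative (Y1 t ** ?B t)) (at t)"
    using Y1 unfolding sol_on_def by (elim conjE exE)
  obtain K2 where K2: "finite K2" "\<forall>t\<in>{b..c} - K2. (Y2 has_vector_derivative (Y2 t ** ?B t)) (at t)"
    using Y2 unfolding sol_on_def by (elim conjE exE)
  have "continuous_on {a..c} ?Y"
  proof (rule continuous_on_cases_1)
    show "continuous_on {t \<in> {a..c}. t \<le> b} Y1"
      using Y1 unfolding sol_on_def by (auto elim: continuous_on_subset)
    show "continuous_on {t \<in> {a..c}. b \<le> t} Y2"
      using Y2 unfolding sol_on_def by (auto elim: continuous_on_subset)
  qed (use eq in auto)
  moreover have "(?Y has_vector_derivative (?Y t ** ?B t)) (at t)"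
    if "t \<in> {a..c} - (K1 \<union> K2 \<union> {b})" for t
  proof (cases "t < b")
    case True
    have "(Y1 has_vector_derivative (?Y t ** ?B t)) (at t)" using K1(2)[rule_format, of t] True that by auto
    then show ?thesis
      by (rule has_vector_derivative_transform_within_open[where S = "{..<b}"]) (use True in auto)
  next
    case False
    then have "t > b" using that by auto
    then have "(Y2 has_vector_derivative (?Y t ** ?B t)) (at t)" using K2(2)[rule_format, of t] that by auto
    then show ?thesis
      by (rule has_vector_derivative_transform_within_open[where S = "{b<..}"]) (use \<open>t > b\<close> in auto)
  qed
  moreover have "finite (K1 \<union> K2 \<union> {b})" using K1 K2 by simp
  ultimately show ?thesis by (intro sol_onI)
qed

text \<open>Constant matrices act on solutions from the left, so T appears on the right and does not
  depend on the initial value. Existence is included to make T unique and the description in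
  \<open>monodromy\<close> well defined.\<close>

definition transport :: "(complex \<Rightarrow> cmat2) \<Rightarrow> (real \<Rightarrow> complex) \<Rightarrow> real \<Rightarrow> real \<Rightarrow> cmat2 \<Rightarrow> bool" where
  "transport A g a b T \<longleftrightarrow>
     (\<forall>X. \<exists>Y. sol_on A g a b Y \<and> Y a = X) \<and> (\<forall>Y. sol_on A g a b Y \<longrightarrow> Y b = Y a ** T)"

lemma transport_unique:
  assumes "transport A g a b T" "transport A g a b T'"
  shows "T = T'"
proof -
  obtain Y where Y: "sol_on A g a b Y" "Y a = mat 1" using assms(1) unfolding transport_def by blast
  have "Y b = Y a ** T" "Y b = Y a ** T'" using assms Y(1) unfolding transport_def by blast+
  then show ?thesis by (simp add: Y(2))
qed

lemma transport_join:
  assumes "a \<le> b" "b \<le> c" "transport A g a b T1" "transport A g b c T2"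
  shows "transport A g a c (T1 ** T2)"
  unfolding transport_def
proof (intro conjI allI impI)
  fix X
  obtain Y1 where Y1: "sol_on A g a b Y1" "Y1 a = X" using assms unfolding transport_def by blast
  obtain Y2 where Y2: "sol_on A g b c Y2" "Y2 b = Y1 b" using assms unfolding transport_def by blast
  show "\<exists>Y. sol_on A g a c Y \<and> Y a = X"
    using sol_on_join[OF assms(1,2) Y1(1) Y2(1) Y2(2)[symmetric]] Y1(2) assms(1)
    by (intro exI[of _ "\<lambda>t. if t \<le> b then Y1 t else Y2 t"]) simp
next
  fix Y assume Y: "sol_on A g a c Y"
  have "sol_on A g a b Y" "sol_on A g b c Y" using sol_on_subset[OF Y] assms by auto
  then have "Y b = Y a ** T1" "Y c = Y b ** T2" using assms(3,4) unfolding transport_def by blast+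
  then show "Y c = Y a ** (T1 ** T2)" by (simp add: matrix_mul_assoc)
qed

lemma monodromy_eq:
  assumes "transport A g 0 1 T"
  shows "monodromy A g X = X ** T ** matrix_inv X"
  unfolding monodromy_def
proof (rule the_equality)
  obtain Y where Y: "sol_on A g 0 1 Y" "Y 0 = X" using assms unfolding transport_def by blast
  then have "Y 1 = X ** T" using assms unfolding transport_def by blast
  then show "\<exists>Y. sol_along A g X Y \<and> X ** T ** matrix_inv X = Y 1 ** matrix_inv X"
    using Y unfolding sol_along_iff_sol_on by (intro exI[of _ Y]) simp
next
  fix M assume "\<exists>Y. sol_along A g X Y \<and> M = Y 1 ** matrix_inv X"
  then obtain Y where Y: "sol_on A g 0 1 Y" "Y 0 = X" "M = Y 1 ** matrix_inv X"
    unfolding sol_along_iff_sol_on by blast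
  then have "Y 1 = X ** T" using assms unfolding transport_def by blast
  then show "M = X ** T ** matrix_inv X" using Y by simp
qed

text \<open>Determinant 1 and trace 0 are built in so that \<open>adj2 (F z)\<close> is the inverse
  of \<open>F z\<close> and solves the adjoint equation.\<close>

definition fundamental_on :: "(complex \<Rightarrow> cmat2) \<Rightarrow> complex set \<Rightarrow> (complex \<Rightarrow> cmat2) \<Rightarrow> bool" where
  "fundamental_on A S F \<longleftrightarrow> open S \<and> (\<forall>z\<in>S. det (F z) = 1 \<and> trace (A z) = 0 \<and>
     (\<forall>i j. ((\<lambda>z. F z $ i $ j) has_field_derivative (F z ** A z) $ i $ j) (at z)))"

lemma sol_on_fundamental:
  assumes F: "fundamental_on A S F" and g: "continuous_on {a..b} g" "g ` {a..b} \<subseteq> S"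
    and K: "finite K" "\<And>t. t \<in> {a..b} - K \<Longrightarrow> g differentiable at t"
  shows "sol_on A g a b (\<lambda>t. F (g t))"
    and "\<And>t. t \<in> {a..b} - K \<Longrightarrow> ((\<lambda>t. F (g t)) has_vector_derivative
           (F (g t) ** (\<chi> i j. A (g t) $ i $ j * vector_derivative g (at t)))) (at t)"
proof -
  have "continuous_on S F"
  proof (rule continuous_on_mat, rule continuous_at_imp_continuous_on, rule ballI)
    fix i j z assume "z \<in> S"
    then show "isCont (\<lambda>x. F x $ i $ j) z" using F DERIV_isCont unfolding fundamental_on_def by blast
  qed
  then have "continuous_on {a..b} (\<lambda>t. F (g t))"
    using continuous_on_compose2 g by blast
  moreover show *: "((\<lambda>t. F (g t)) has_vector_derivative
      (F (g t) ** (\<chi> i j. A (g t) $ i $ j * vector_derivative g (at t)))) (at t)"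
    if t: "t \<in> {a..b} - K" for t
  proof (rule has_vector_derivative_mat)
    fix i j
    have "(g has_vector_derivative vector_derivative g (at t)) (at t)"
      using K(2)[OF t] vector_derivative_works by blast
    moreover have "((\<lambda>z. F z $ i $ j) has_field_derivative (F (g t) ** A (g t)) $ i $ j) (at (g t))"
      using F g t unfolding fundamental_on_def by blast
    ultimately have "((\<lambda>z. F z $ i $ j) \<circ> g has_vector_derivative
        vector_derivative g (at t) * (F (g t) ** A (g t)) $ i $ j) (at t)"
      by (rule field_vector_diff_chain_at)
    then show "((\<lambda>x. F (g x) $ i $ j) has_vector_derivative
        (F (g t) ** (\<chi> i j. A (g t) $ i $ j * vector_derivative g (at t))) $ i $ j) (at t)"
      by (simp add: o_def mat2_mult_nth algebra_simps)
  qed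
  ultimately show "sol_on A g a b (\<lambda>t. F (g t))"
    using K(1) by (intro sol_onI)
qed

lemma sol_on_mult_left:
  assumes "sol_on A g a b Y"
  shows "sol_on A g a b (\<lambda>t. X ** Y t)"
proof -
  have bl: "bounded_linear ((**) X :: cmat2 \<Rightarrow> cmat2)"
    by (rule bounded_bilinear.bounded_linear_right[OF bounded_bilinear_matrix_mult])
  obtain K where "continuous_on {a..b} Y" "finite K"
    "\<forall>t\<in>{a..b} - K. (Y has_vector_derivative
           (Y t ** (\<chi> i j. A (g t) $ i $ j * vector_derivative g (at t)))) (at t)"
    using assms unfolding sol_on_def by (elim conjE exE)
  then show ?thesis
    unfolding sol_on_def matrix_mul_assoc[symmetric]
    by (intro conjI exI[of _ K] ballI bounded_linear.has_vector_derivative[OF bl]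
        bounded_linear.continuous_on[OF bl]) auto
qed

lemma transport_fundamental:
  assumes F: "fundamental_on A S F" and ab: "a \<le> b" 
    and g: "continuous_on {a..b} g" "g ` {a..b} \<subseteq> S"
    and K: "finite K" "\<And>t. t \<in> {a..b} - K \<Longrightarrow> g differentiable at t"
  shows "transport A g a b (adj2 (F (g a)) ** F (g b))"
  unfolding transport_def
proof (intro conjI allI impI)
  have det: "det (F (g t)) = 1" "trace (A (g t)) = 0" if "t \<in> {a..b}" for t
    using F g that unfolding fundamental_on_def by blast+
  note sol = sol_on_fundamental[OF assms(1) g K]
  fix X :: cmat2
  have "X ** adj2 (F (g a)) ** F (g a) = X"
    using det[of a] ab by (simp add: mult_adj2 flip: matrix_mul_assoc)
  then show "\<exists>Y. sol_on A g a b Y \<and> Y a = X"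
    using sol_on_mult_left[OF sol(1), of "X ** adj2 (F (g a))"] by blast
next
  have det: "det (F (g t)) = 1" "trace (A (g t)) = 0" if "t \<in> {a..b}" for t
    using F g that unfolding fundamental_on_def by blast+
  note sol = sol_on_fundamental[OF assms(1) g K]
  fix Y assume Y: "sol_on A g a b Y"
  let ?B = "\<lambda>t. (\<chi> i j. A (g t) $ i $ j * vector_derivative g (at t)) :: cmat2"
  obtain L where L: "finite L" "\<forall>t\<in>{a..b} - L. (Y has_vector_derivative (Y t ** ?B t)) (at t)"
    using Y unfolding sol_on_def by (elim conjE exE)
  \<comment> \<open>Uniqueness: for every solution Y the product of Y with the inverse of F is
    constant.\<close>
  define W where "W t = Y t ** adj2 (F (g t))" for t
  have cW: "continuous_on {a..b} W"
    using Y sol(1) unfolding sol_on_def W_def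
    by (intro bounded_bilinear.continuous_on[OF bounded_bilinear_matrix_mult]
        bounded_linear.continuous_on[OF bounded_linear_adj2]) auto
  have dW: "(W has_derivative (\<lambda>h. 0)) (at t within {a..b})" if t: "t \<in> {a..b} - (K \<union> L)" for t
  proof -
    \<comment> \<open>The adjugate of a trace-free matrix is its negative, so the two terms of the
      product rule cancel.\<close>
    have "adj2 (?B t) = - ?B t" 
      using det(2)[of t] t by (simp add: mat2_simps adj2_nth add_eq_0_iff2 flip: distrib_right)
    then have adjFB: "adj2 (F (g t) ** ?B t) = - (?B t ** adj2 (F (g t)))"
      by (simp add: adj2_mult mat2_simps)
    have "(W has_vector_derivative
        (Y t ** adj2 (F (g t) ** ?B t) + (Y t ** ?B t) ** adj2 (F (g t)))) (at t)"
      unfolding W_def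
      by (intro bounded_bilinear.has_vector_derivative[OF bounded_bilinear_matrix_mult]
        bounded_linear.has_vector_derivative[OF bounded_linear_adj2] sol(2) L(2)[rule_format]) (use t in auto)
    also have "Y t ** adj2 (F (g t) ** ?B t) + (Y t ** ?B t) ** adj2 (F (g t)) = 0"
      unfolding adjFB by (simp add: mat2_simps algebra_simps)
    finally show ?thesis unfolding has_vector_derivative_def by (simp add: has_derivative_at_withinI)
  qed
  have "W b = W a"
    using has_derivative_zero_unique_strong_interval[of "K \<union> L" a b W "W a" b] cW dW ab K L by auto
  then have "Y b ** adj2 (F (g b)) ** F (g b) = Y a ** adj2 (F (g a)) ** F (g b)"
    by (simp add: W_def)
  then show "Y b = Y a ** (adj2 (F (g a)) ** F (g b))"
    using det[of b] ab by (simp add: mult_adj2 flip: matrix_mul_assoc)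
qed

section \<open>Fundamental solutions on star-shaped domains\<close>

lemma exists_primitive_at:
  fixes f :: "complex \<Rightarrow> complex"
  assumes "open S" "p \<in> S" "\<And>z. z \<in> S \<Longrightarrow> closed_segment p z \<subseteq> S" "f holomorphic_on S"
  obtains h where "h p = 0" "\<And>z. z \<in> S \<Longrightarrow> (h has_field_derivative f z) (at z)"
proof -
  have "starlike S" using assms unfolding starlike_def by blast
  then have "\<exists>g. \<forall>x\<in>S. (g has_field_derivative f x) (at x)"
    using assms holomorphic_on_imp_differentiable_at[OF assms(4,1)]
    by (intro holomorphic_starlike_primitive[of S f "{}"] holomorphic_on_imp_continuous_on) auto
  then obtain g where g: "\<And>x. x \<in> S \<Longrightarrow> (g has_field_derivative f x) (at x)" by blast
  show thesis
  proof (rule that[of "\<lambda>z. g z - g p"])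
    show "((\<lambda>z. g z - g p) has_field_derivative f z) (at z)" if "z \<in> S" for z
      using g[OF that] by (auto intro!: derivative_eq_intros)
  qed simp
qed

text \<open>The induction step for the exponential series bound. The parameter on the segment is
  kept in the bound so that it can be integrated; the factor 2 counts the summands in an entry of a
  2 by 2 product.\<close>

lemma picard_step_bound:
  fixes F G A :: "complex \<Rightarrow> cmat2"
  assumes seg: "closed_segment p z \<subseteq> S" and p: "\<And>i j. G p $ i $ j = 0"
    and G: "\<And>i j z. z \<in> S \<Longrightarrow> ((\<lambda>z. G z $ i $ j) has_field_derivative (F z ** A z) $ i $ j) (at z)"
    and A: "\<And>i j \<tau>. 0 \<le> \<tau> \<Longrightarrow> \<tau> \<le> 1 \<Longrightarrow> norm (A (p + of_real \<tau> * (z - p)) $ i $ j) \<le> M"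
    and F: "\<And>i j \<tau>. 0 \<le> \<tau> \<Longrightarrow> \<tau> \<le> 1 \<Longrightarrow>
        norm (F (p + of_real \<tau> * (z - p)) $ i $ j) \<le> (2 * M * norm (z - p) * \<tau>) ^ n / fact n"
    and \<tau>: "0 \<le> \<tau>" "\<tau> \<le> 1"
  shows "norm (G (p + of_real \<tau> * (z - p)) $ i $ j) \<le> (2 * M * norm (z - p) * \<tau>) ^ Suc n / fact (Suc n)"
proof -
  define K where "K = 2 * M * norm (z - p)"
  have M: "M \<ge> 0" using order_trans[OF norm_ge_zero A[of 0 1 1]] by simp
  define \<gamma> where "\<gamma> t = p + of_real t * (z - p)" for t :: real
  have \<gamma>S: "\<gamma> t \<in> S" if "0 \<le> t" "t \<le> 1" for t
  proof -
    have "\<gamma> t = (1 - t) *\<^sub>R p + t *\<^sub>R z" by (simp add: \<gamma>_def scaleR_conv_of_real algebra_simps)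
    then show ?thesis using seg that by (auto simp: closed_segment_def)
  qed
  have d\<gamma>: "(\<gamma> has_vector_derivative (z - p)) (at t)" for t
    unfolding \<gamma>_def by (auto intro!: derivative_eq_intros simp: has_vector_derivative_def scaleR_conv_of_real)
  define f where "f t = G (\<gamma> t) $ i $ j" for t
  define f' where "f' t = (z - p) * (F (\<gamma> t) ** A (\<gamma> t)) $ i $ j" for t
  have f: "(f has_vector_derivative f' t) (at t)" if "t \<in> {0..\<tau>}" for t
    using field_vector_diff_chain_at[OF d\<gamma> G[of "\<gamma> t" i j]] \<gamma>S[of t] that \<tau>
    by (simp add: f_def[abs_def] f'_def o_def)
  have "norm (f \<tau> - f 0) \<le> (K * \<tau>) ^ Suc n / fact (Suc n) - (K * 0) ^ Suc n / fact (Suc n)"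
  proof (rule norm_diff_le_if_derivative_le[of "{}" 0 \<tau> f f' "\<lambda>t. (K * t) ^ Suc n / fact (Suc n)"
        "\<lambda>t. K * ((K * t) ^ n / fact n)"])
    show "continuous_on {0..\<tau>} f"
      by (auto intro!: continuous_at_imp_continuous_on has_vector_derivative_continuous[OF f])
    show "((\<lambda>t. (K * t) ^ Suc n / fact (Suc n)) has_real_derivative K * ((K * t) ^ n / fact n)) (at t)" for t
      by (rule DERIV_cong[OF DERIV_cdivide[OF DERIV_power[OF DERIV_cmult_Id]]])
        (simp add: divide_simps del: power_Suc)
    show "norm (f' t) \<le> K * ((K * t) ^ n / fact n)" if "t \<in> {0..\<tau>} - {}" for t
    proof -
      let ?b = "(K * t) ^ n / fact n"
      have t: "0 \<le> t" "t \<le> 1" using that \<tau> by auto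
      have "norm ((F (\<gamma> t) ** A (\<gamma> t)) $ i $ j) \<le> norm (F (\<gamma> t) $ i $ 1) * norm (A (\<gamma> t) $ 1 $ j)
          + norm (F (\<gamma> t) $ i $ 2) * norm (A (\<gamma> t) $ 2 $ j)"
        unfolding mat2_mult_nth norm_mult[symmetric] by (rule norm_triangle_ineq)
      also have "\<dots> \<le> ?b * M + ?b * M"
        using A[OF t] F[OF t] M unfolding \<gamma>_def K_def
        using t by (intro add_mono mult_mono) auto
      finally have "norm (f' t) \<le> norm (z - p) * (?b * M + ?b * M)"
        unfolding f'_def norm_mult by (intro mult_left_mono) auto
      then show ?thesis by (simp add: K_def algebra_simps)
    qed
  qed (use \<tau> f in \<open>auto intro!: continuous_intros\<close>)
  then show ?thesis by (simp add: f_def \<gamma>_def K_def p)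
qed

theorem fundamental_on_starlike_exists:
  fixes A :: "complex \<Rightarrow> cmat2"
  assumes S: "open S" "p \<in> S" "\<And>z. z \<in> S \<Longrightarrow> closed_segment p z \<subseteq> S"
    and A: "\<And>i j. (\<lambda>z. A z $ i $ j) holomorphic_on S" and tr: "\<And>z. z \<in> S \<Longrightarrow> trace (A z) = 0"
  obtains F where "fundamental_on A S F"
proof -
  define P where "P n G \<longleftrightarrow> (\<forall>i j. (\<lambda>z. G z $ i $ j) holomorphic_on S) \<and> (n = 0 \<longrightarrow> G = (\<lambda>_. mat 1))"
    for n :: nat and G :: "complex \<Rightarrow> cmat2"
  define Q where "Q F G \<longleftrightarrow> (\<forall>i j. G p $ i $ j = 0 \<and>
      (\<forall>z\<in>S. ((\<lambda>z. G z $ i $ j) has_field_derivative (F z ** A z) $ i $ j) (at z)))"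
    for F G :: "complex \<Rightarrow> cmat2"
  \<comment> \<open>Picard iteration from the constant \<open>mat 1\<close>. An iterate is known
    only through the existence of a primitive vanishing at p, hence the dependent choice; P keeps
    the iterates holomorphic so that the next primitive exists.\<close>
  have "\<exists>f. \<forall>n. P n (f n) \<and> Q (f n) (f (Suc n))"
  proof (rule dependent_nat_choice[where Q = "\<lambda>n. Q"])
    show "\<exists>x. P 0 x" unfolding P_def by auto
    fix F n assume F: "P n F"
    have ex: "\<exists>h. h p = 0 \<and> (\<forall>z\<in>S. (h has_field_derivative (F z ** A z) $ i $ j) (at z))" for i j
    proof -
      have "(\<lambda>z. (F z ** A z) $ i $ j) holomorphic_on S"
        unfolding mat2_mult_nth using F A unfolding P_def by (intro holomorphic_intros) auto
      from exists_primitive_at[OF S this] obtain h where "h p = 0"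
        "\<And>z. z \<in> S \<Longrightarrow> (h has_field_derivative (F z ** A z) $ i $ j) (at z)" by blast
      then show ?thesis by (intro exI[of _ h]) simp
    qed
    define h where "h i j = (SOME h. h p = 0 \<and>
        (\<forall>z\<in>S. (h has_field_derivative (F z ** A z) $ i $ j) (at z)))" for i j
    have h: "h i j p = 0" "z \<in> S \<Longrightarrow> (h i j has_field_derivative (F z ** A z) $ i $ j) (at z)" for i j z
      using someI_ex[OF ex[of i j]] unfolding h_def by simp_all
    define G :: "complex \<Rightarrow> cmat2" where "G z = (\<chi> i j. h i j z)" for z
    have "h i j holomorphic_on S" for i j
      using h(2) by (auto simp: holomorphic_on_open[OF S(1)])
    then have "P (Suc n) G" "Q F G" using h unfolding P_def Q_def G_def by auto
    then show "\<exists>y. P (Suc n) y \<and> Q F y" by (intro exI[of _ G] conjI)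
  qed
  then obtain f where f: "\<And>n. P n (f n)" "\<And>n. Q (f n) (f (Suc n))" by blast
  have f0: "f 0 = (\<lambda>_. mat 1)" using f(1)[of 0] by (simp add: P_def)
  have fp: "f (Suc n) p $ i $ j = 0" for n i j using f(2)[of n] by (simp add: Q_def)
  have fS: "((\<lambda>z. f (Suc n) z $ i $ j) has_field_derivative (f n z ** A z) $ i $ j) (at z)"
    if "z \<in> S" for n i j z using f(2)[of n] that by (simp add: Q_def)
  have bound: "norm (f n (p + of_real \<tau> * (z - p)) $ i $ j) \<le> (2 * M * norm (z - p) * \<tau>) ^ n / fact n"
    if "z \<in> S" "\<And>i j \<tau>. 0 \<le> \<tau> \<Longrightarrow> \<tau> \<le> 1 \<Longrightarrow> norm (A (p + of_real \<tau> * (z - p)) $ i $ j) \<le> M"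
      "0 \<le> \<tau>" "\<tau> \<le> 1" for z M \<tau> n i j
    using that(3,4)
  proof (induction n arbitrary: \<tau> i j)
    case 0
    then show ?case by (simp add: f0 mat_def)
  next
    case (Suc n)
    show ?case
      by (rule picard_step_bound[OF S(3)[OF that(1)] fp fS that(2) Suc.IH Suc.prems])
  qed
  have contA: "continuous_on S A"
    by (intro continuous_on_mat holomorphic_on_imp_continuous_on A)
  have local: "\<exists>d h. 0 < d \<and> summable h \<and>
      (\<forall>\<^sub>F n in sequentially. \<forall>y\<in>ball x d \<inter> S. norm (f n y $ i $ j) \<le> h n)" if x: "x \<in> S" for x i j
  proof -
    obtain d where d: "d > 0" "cball x d \<subseteq> S" using S(1) x open_contains_cball by blast
    \<comment> \<open>The union of the segments from p to a closed ball around x. It is compact, so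
      one bound for A serves all iterates on the ball.\<close>
    define C where "C = (\<lambda>(\<tau>, z). p + of_real \<tau> * (z - p)) ` ({0..1::real} \<times> cball x d)"
    have "compact C" unfolding C_def
      by (intro compact_continuous_image compact_Times)
        (auto intro!: continuous_intros simp: case_prod_unfold)
    moreover have "C \<subseteq> S"
    proof -
      have "p + of_real \<tau> * (z - p) \<in> S" if "0 \<le> \<tau>" "\<tau> \<le> 1" "z \<in> cball x d" for \<tau> z
      proof -
        have "p + of_real \<tau> * (z - p) = (1 - \<tau>) *\<^sub>R p + \<tau> *\<^sub>R z"
          by (simp add: scaleR_conv_of_real algebra_simps)
        moreover have "closed_segment p z \<subseteq> S" using S(3) d(2) that by blast
        ultimately show ?thesis using that by (auto simp: closed_segment_def)
      qed
      then show ?thesis unfolding C_def by auto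
    qed
    ultimately have "bounded (A ` C)"
      by (intro compact_imp_bounded compact_continuous_image continuous_on_subset[OF contA])
    then obtain M where M: "\<And>z. z \<in> C \<Longrightarrow> norm (A z) \<le> M" unfolding bounded_iff by blast
    define K where "K = 2 * M * (norm (x - p) + d)"
    have "x \<in> C" unfolding C_def using d(1) by (intro image_eqI[of _ _ "(1, x)"]) auto
    then have M0: "M \<ge> 0" using M order_trans[OF norm_ge_zero] by blast
    have "norm (f n y $ i $ j) \<le> inverse (fact n) * K ^ n" if y: "y \<in> ball x d \<inter> S" for n y
    proof -
      have "norm (A (p + of_real \<tau> * (y - p)) $ i $ j) \<le> M" if "0 \<le> \<tau>" "\<tau> \<le> 1" for i j \<tau>
      proof -
        have "p + of_real \<tau> * (y - p) \<in> C" unfolding C_def using that y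
          by (intro image_eqI[of _ _ "(\<tau>, y)"]) auto
        then show ?thesis by (rule order_trans[OF norm_mat2_nth_le M])
      qed
      then have "norm (f n (p + of_real 1 * (y - p)) $ i $ j) \<le> (2 * M * norm (y - p) * 1) ^ n / fact n"
        using y by (intro bound) auto
      moreover have "(2 * M * norm (y - p)) ^ n \<le> K ^ n"
        unfolding K_def using M0 y d(1) norm_triangle_ineq[of "y - x" "x - p"]
        by (intro power_mono mult_left_mono) (auto simp: dist_norm norm_minus_commute)
      then have "(2 * M * norm (y - p) * 1) ^ n / fact n \<le> K ^ n / fact n"
        by (intro divide_right_mono) auto
      ultimately show ?thesis by (simp add: field_simps)
    qed
    then show ?thesis using d(1) summable_exp[of K]
      by (intro exI[of _ d] exI[of _ "\<lambda>n. inverse (fact n) * K ^ n"]) auto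
  qed
  \<comment> \<open>Termwise differentiation multiplies by A and shifts the index by one; the term
    for n = 0 vanishes because \<open>f 0\<close> is constant.\<close>
  define f' where "f' n i j z = (if n = 0 then 0 else (f (n - 1) z ** A z) $ i $ j)" for n i j z
  have df: "((\<lambda>z. f n z $ i $ j) has_field_derivative f' n i j z) (at z)" if "z \<in> S" for n i j z
    using fS[OF that, of "n - 1" i j] by (cases n) (simp_all add: f'_def f0)
  define F :: "complex \<Rightarrow> cmat2" where "F z = (\<chi> i j. \<Sum>n. f n z $ i $ j)" for z
  have series: "(\<lambda>n. f n x $ i $ j) sums (F x $ i $ j) \<and>
      (\<exists>D. (\<lambda>n. f' n i j x) sums D \<and> ((\<lambda>z. F z $ i $ j) has_field_derivative D) (at x))"
    if x: "x \<in> S" for x i j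
  proof -
    obtain g g' where g: "\<forall>x\<in>S. (\<lambda>n. f n x $ i $ j) sums g x \<and> (\<lambda>n. f' n i j x) sums g' x \<and>
        (g has_field_derivative g' x) (at x)"
      using series_and_derivative_comparison_local[OF S(1), of "\<lambda>n z. f n z $ i $ j" "\<lambda>n. f' n i j"]
        df local by auto
    then have gF: "g z = F z $ i $ j" if "z \<in> S" for z
      using that by (simp add: F_def sums_unique)
    have "((\<lambda>z. F z $ i $ j) has_field_derivative g' x) (at x)"
      by (rule has_field_derivative_transform_within_open[OF _ S(1) x gF]) (use g x in auto)
    then show ?thesis using g x gF[OF x] by auto
  qed
  have dF: "((\<lambda>z. F z $ i $ j) has_field_derivative (F z ** A z) $ i $ j) (at z)"
    if z: "z \<in> S" for i j z
  proof -
    obtain D where D: "(\<lambda>n. f' n i j z) sums D" "((\<lambda>z. F z $ i $ j) has_field_derivative D) (at z)"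
      using series[OF z] by blast
    have "(\<lambda>n. f n z $ i $ 1 * A z $ 1 $ j + f n z $ i $ 2 * A z $ 2 $ j) sums
        (F z $ i $ 1 * A z $ 1 $ j + F z $ i $ 2 * A z $ 2 $ j)"
      using series[OF z] by (intro sums_add sums_mult2) auto
    then have "(\<lambda>n. f' (Suc n) i j z) sums (F z ** A z) $ i $ j"
      by (simp add: f'_def mat2_mult_nth)
    then have "(\<lambda>n. f' n i j z) sums (F z ** A z) $ i $ j"
      by (subst (asm) sums_Suc_iff) (simp add: f'_def)
    then have "D = (F z ** A z) $ i $ j" using D(1) sums_unique2 by blast
    then show ?thesis using D(2) by simp
  qed
  have "F p = mat 1"
  proof -
    have "F p $ i $ j = mat 1 $ i $ j" for i j
    proof -
      have "(\<lambda>n. f n p $ i $ j) sums (\<Sum>n\<in>{0}. f n p $ i $ j)"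
        by (rule sums_finite) (auto simp: fp gr0_conv_Suc)
      moreover have "(\<lambda>n. f n p $ i $ j) sums (F p $ i $ j)" using series[OF S(2)] by blast
      ultimately have "F p $ i $ j = (\<Sum>n\<in>{0}. f n p $ i $ j)" by (metis sums_unique2)
      then show ?thesis by (simp add: f0)
    qed
    then show ?thesis by (simp add: vec_eq_iff)
  qed
  \<comment> \<open>Liouville's formula for a trace-free coefficient.\<close>
  moreover have "(\<lambda>z. det (F z)) constant_on S"
  proof (rule DERIV_zero_connected_constant_on[of S "{}"])
    show "connected S" using S by (intro starlike_imp_connected) (auto simp: starlike_def)
    have d: "((\<lambda>z. det (F z)) has_field_derivative 0) (at z)" if z: "z \<in> S" for z
    proof -
      have "A z $ 2 $ 2 = - A z $ 1 $ 1" using tr[OF z] by (simp add: trace_2 add_eq_0_iff2)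
      then show ?thesis unfolding det_2
        by (auto intro!: derivative_eq_intros dF z simp: mat2_mult_nth algebra_simps)
    qed
    then show "continuous_on S (\<lambda>z. det (F z))" 
      by (intro continuous_at_imp_continuous_on ballI DERIV_isCont)
    show "\<forall>z\<in>S - {}. ((\<lambda>z. det (F z)) has_field_derivative 0) (at z)" using d by simp
  qed (use S in auto)
  then obtain c where "\<forall>z\<in>S. det (F z) = c" unfolding constant_on_def by blast
  ultimately have "det (F z) = 1" if "z \<in> S" for z
    using that S(2) by (metis det_I)
  then have "fundamental_on A S F" unfolding fundamental_on_def using S(1) tr dF by simp
  then show thesis by (rule that)
qed

section \<open>Transport along circles around a regular singular point\<close>

text \<open>A complex radius also encodes the starting point: \<open>loop1\<close> is a circle about
  1 with radius -1/2.\<close>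

definition circle :: "complex \<Rightarrow> complex \<Rightarrow> real \<Rightarrow> complex" where
  "circle c \<rho> t = c + \<rho> * exp (2 * of_real pi * \<i> * of_real t)"

lemma circle_has_vector_derivative:
  "(circle c \<rho> has_vector_derivative (2 * of_real pi * \<i> * (circle c \<rho> t - c))) (at t)"
proof -
  have "((\<lambda>t. exp (t *\<^sub>R (2 * of_real pi * \<i>))) has_vector_derivative
      exp (t *\<^sub>R (2 * of_real pi * \<i>)) * (2 * of_real pi * \<i>)) (at t)"
    by (rule exp_scaleR_has_vector_derivative_right)
  then have "((\<lambda>t. c + \<rho> * exp (t *\<^sub>R (2 * of_real pi * \<i>))) has_vector_derivative
      0 + \<rho> * (exp (t *\<^sub>R (2 * of_real pi * \<i>)) * (2 * of_real pi * \<i>))) (at t)"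
    by (intro has_vector_derivative_add has_vector_derivative_const has_vector_derivative_mult_right)
  then show ?thesis
    unfolding circle_def[abs_def] by (simp add: scaleR_conv_of_real mult_ac)
qed

lemma norm_mat2_le: "norm (M :: cmat2) \<le> norm (M$1$1) + norm (M$1$2) + norm (M$2$1) + norm (M$2$2)"
proof -
  have "norm M \<le> norm (M$1) + norm (M$2)"
    using L2_set_le_sum[of UNIV "\<lambda>i. norm (M $ i)"] by (simp add: norm_vec_def[of M] sum_2)
  moreover have "norm (M$i) \<le> norm (M$i$1) + norm (M$i$2)" for i
    using L2_set_le_sum[of UNIV "\<lambda>j. norm (M $ i $ j)"] by (simp add: norm_vec_def[of "M $ i"] sum_2)
  ultimately show ?thesis by (smt (verit))
qed

text \<open>Multiplying solutions by the matrix \<open>H\<close> of the proof, which solves the equation with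
  \<open>(z - c)\<^sup>2 q(z) / \<lambda>\<close> replaced by its limiting value \<open>-r1 r2\<close>, turns the equation on a
  small circle into a small perturbation of the trivial one.\<close>
lemma circle_trace_bound:
  fixes q :: "complex \<Rightarrow> complex" and lam c \<rho> :: complex and r1 r2 \<delta> :: real
  defines "A \<equiv> \<lambda>z. vector [vector [0, inverse lam], vector [q z, 0]] :: cmat2"
  assumes T: "transport A (circle c \<rho>) 0 1 T" and nz: "lam \<noteq> 0" "\<rho> \<noteq> 0"
    and r: "r1 + r2 = 1" "r1 \<noteq> r2" and \<delta>: "\<delta> \<ge> 0"
    and q: "\<And>t. norm (inverse lam * q (circle c \<rho> t) * (circle c \<rho> t - c)\<^sup>2 + of_real (r1 * r2)) \<le> \<delta>"
  shows "norm (trace T - (exp (2 * of_real pi * \<i> * of_real r1) + exp (2 * of_real pi * \<i> * of_real r2)))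
      \<le> 8 * (16 * pi / \<bar>r1 - r2\<bar> * \<delta> * exp (16 * pi / \<bar>r1 - r2\<bar> * \<delta>))"
proof -
  \<comment> \<open>16 pi collects 4 for the matrix entries, 2 for recovering Y from two entries of
    \<open>W\<close>, and 2 pi for the speed of the circle.\<close>
  define C where "C = 16 * pi / \<bar>r1 - r2\<bar> * \<delta>"
  have C: "C \<ge> 0" using \<delta> by (simp add: C_def)
  define g where "g = circle c \<rho>"
  define \<zeta> where "\<zeta> t = g t - c" for t
  \<comment> \<open>\<open>e x\<close> is the power ((z - c) / \<rho>)^(-x) continued along the
    circle. It has modulus 1, so the bounds below do not involve \<rho>.\<close>
  define e where "e x t = exp (t *\<^sub>R (- (2 * of_real pi * \<i> * of_real x)))" for x t :: real
  have dg: "(g has_vector_derivative (2 * of_real pi * \<i> * \<zeta> t)) (at t)" for t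
    unfolding g_def \<zeta>_def by (rule circle_has_vector_derivative)
  have d\<zeta>: "(\<zeta> has_vector_derivative (2 * of_real pi * \<i> * \<zeta> t)) (at t)" for t
    unfolding \<zeta>_def[abs_def] using has_vector_derivative_diff[OF dg has_vector_derivative_const]
    by (simp add: \<zeta>_def)
  have de: "(e x has_vector_derivative (- 2 * of_real pi * \<i> * of_real x) * e x t) (at t)" for x t
    unfolding e_def[abs_def]
    using exp_scaleR_has_vector_derivative_right[of "- (2 * of_real pi * \<i> * of_real x)" t UNIV]
    by (simp add: mult_ac)
  have ne: "norm (e x t) = 1" for x t by (simp add: e_def)
  have e0: "e x 0 = 1" for x by (simp add: e_def)
  have e1: "e x 1 * exp (2 * of_real pi * \<i> * of_real x) = 1" for x
    by (simp add: e_def flip: exp_add)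
  \<comment> \<open>The columns solve the adjoint of the Euler equation: row solutions of the Euler
    equation have constant products with them. They are independent because r1 \<noteq> r2.\<close>
  define H :: "real \<Rightarrow> cmat2" where "H t = vector [
      vector [\<zeta> t * inverse lam * e r1 t, \<zeta> t * inverse lam * e r2 t],
      vector [of_real (r1 - 1) * e r1 t, of_real (r2 - 1) * e r2 t]]" for t
  define H' :: "real \<Rightarrow> cmat2" where "H' t = vector [
      vector [2 * of_real pi * \<i> * of_real (1 - r1) * \<zeta> t * inverse lam * e r1 t,
        2 * of_real pi * \<i> * of_real (1 - r2) * \<zeta> t * inverse lam * e r2 t],
      vector [- 2 * of_real pi * \<i> * of_real (r1 * (r1 - 1)) * e r1 t,
        - 2 * of_real pi * \<i> * of_real (r2 * (r2 - 1)) * e r2 t]]" for t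
  have dze: "((\<lambda>t. \<zeta> t * inverse lam * e x t) has_vector_derivative
      2 * of_real pi * \<i> * of_real (1 - x) * \<zeta> t * inverse lam * e x t) (at t)" for x t
  proof -
    have "((\<lambda>t. \<zeta> t * inverse lam * e x t) has_vector_derivative
       (\<zeta> t * inverse lam) * ((- 2 * of_real pi * \<i> * of_real x) * e x t)
         + (2 * of_real pi * \<i> * \<zeta> t * inverse lam) * e x t) (at t)"
      by (intro has_vector_derivative_mult has_vector_derivative_mult_left d\<zeta> de)
    then show ?thesis by (simp add: algebra_simps)
  qed
  have dre: "((\<lambda>t. of_real (x - 1) * e x t) has_vector_derivative
      - 2 * of_real pi * \<i> * of_real (x * (x - 1)) * e x t) (at t)" for x t
    using has_vector_derivative_mult_right[OF de, of "of_real (x - 1)" x t] by (simp add: algebra_simps)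
  have dH: "(H has_vector_derivative H' t) (at t)" for t
  proof (rule has_vector_derivative_mat)
    fix i j :: 2
    show "((\<lambda>x. H x $ i $ j) has_vector_derivative H' t $ i $ j) (at t)"
      using exhaust_2[of i] exhaust_2[of j] dze dre unfolding H_def H'_def by auto
  qed
  have contH: "continuous_on {0..1} H"
    by (intro continuous_at_imp_continuous_on ballI has_vector_derivative_continuous[OF dH])
  have \<zeta>0: "\<zeta> 0 = \<rho>" "\<zeta> 1 = \<rho>" by (simp_all add: \<zeta>_def g_def circle_def exp_two_pi_i mult.commute)
  have "det (H 0) = \<rho> * inverse lam * of_real (r2 - r1)"
    by (simp add: H_def det_2 e0 \<zeta>0 algebra_simps)
  then have inv: "invertible (H 0)" using nz r by (simp add: invertible_det_nz)
  define X where "X = matrix_inv (H 0)"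
  have XH: "X ** H 0 = mat 1" "H 0 ** X = mat 1" using matrix_inv_mult[OF inv] by (simp_all add: X_def)
  obtain Y where Y: "sol_on A g 0 1 Y" "Y 0 = X" using T unfolding transport_def g_def by blast
  have Y1: "Y 1 = X ** T" using T Y unfolding transport_def g_def by blast
  obtain K where K: "continuous_on {0..1} Y" "finite K" "\<forall>t\<in>{0..1} - K. (Y has_vector_derivative
       (Y t ** (\<chi> i j. A (g t) $ i $ j * vector_derivative g (at t)))) (at t)"
    using Y(1) unfolding sol_on_def by (elim conjE exE)
  define d where "d t = inverse lam * q (g t) * (\<zeta> t)\<^sup>2 + of_real (r1 * r2)" for t
  have nd: "norm (d t) \<le> \<delta>" for t using q by (simp add: d_def g_def \<zeta>_def)
  define R :: "real \<Rightarrow> cmat2" where "R t = vector [vector [0, 0],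
      vector [2 * of_real pi * \<i> * d t * e r1 t, 2 * of_real pi * \<i> * d t * e r2 t]]" for t
  define W where "W t = Y t ** H t" for t
  have rr: "r2 = 1 - r1" using r by simp
  have dW: "(W has_vector_derivative Y t ** R t) (at t)" if t: "t \<in> {0..1} - K" for t
  proof -
    let ?B = "\<chi> i j. A (g t) $ i $ j * vector_derivative g (at t)"
    have "(W has_vector_derivative (Y t ** H' t + (Y t ** ?B) ** H t)) (at t)"
      unfolding W_def using K(3) t dH
      by (intro bounded_bilinear.has_vector_derivative[OF bounded_bilinear_matrix_mult]) auto
    also have "Y t ** H' t + (Y t ** ?B) ** H t = Y t ** (H' t + ?B ** H t)"
      by (simp add: matrix_add_ldistrib matrix_mul_assoc)
    also have "H' t + ?B ** H t = R t"
      unfolding vector_derivative_at[OF dg] A_def H_def H'_def R_def d_def rr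
      by (simp add: mat2_simps algebra_simps power2_eq_square)
    finally show ?thesis .
  qed
  have le: "norm (Y t ** R t) \<le> C * norm (W t)" for t
  proof -
    have y: "norm (Y t $ i $ 2) \<le> 2 * norm (W t) / \<bar>r1 - r2\<bar>" for i
    proof -
      \<comment> \<open>Eliminates the first column of Y from the two entries of a row of
        \<open>W\<close>. The second column is enough because the first row of \<open>R\<close> is
        zero.\<close>
      have "of_real (r1 - r2) * (e r1 t * e r2 t) * Y t $ i $ 2 = e r2 t * W t $ i $ 1 - e r1 t * W t $ i $ 2"
        unfolding W_def mat2_mult_nth by (simp add: H_def algebra_simps)
      then have "norm (of_real (r1 - r2) * (e r1 t * e r2 t) * Y t $ i $ 2)
          \<le> norm (e r2 t * W t $ i $ 1) + norm (e r1 t * W t $ i $ 2)"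
        by (simp only: norm_triangle_ineq4)
      then have "\<bar>r1 - r2\<bar> * norm (Y t $ i $ 2) \<le> norm (W t $ i $ 1) + norm (W t $ i $ 2)"
        by (simp only: norm_mult ne norm_of_real mult_1 mult_1_right)
      also have "\<dots> \<le> 2 * norm (W t)" using norm_mat2_nth_le[of "W t" i 1] norm_mat2_nth_le[of "W t" i 2] by simp
      finally show ?thesis using r by (simp add: field_simps)
    qed
    define b where "b = (2 * norm (W t) / \<bar>r1 - r2\<bar>) * (2 * pi * \<delta>)"
    have ent: "norm ((Y t ** R t) $ i $ j) \<le> b" for i j
    proof -
      have "(Y t ** R t) $ i $ j = Y t $ i $ 2 * R t $ 2 $ j"
        using exhaust_2[of j] unfolding mat2_mult_nth by (auto simp: R_def)
      moreover have "norm (R t $ 2 $ j) = 2 * pi * norm (d t)"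
        using exhaust_2[of j] by (auto simp: R_def norm_mult ne)
      ultimately have "norm ((Y t ** R t) $ i $ j) = norm (Y t $ i $ 2) * (2 * pi * norm (d t))"
        by (simp add: norm_mult)
      also have "\<dots> \<le> b"
        unfolding b_def using y[of i] nd[of t] by (intro mult_mono) auto
      finally show ?thesis .
    qed
    have "norm (Y t ** R t) \<le> 4 * b"
      using norm_mat2_le[of "Y t ** R t"] ent[of 1 1] ent[of 1 2] ent[of 2 1] ent[of 2 2] by linarith
    then show ?thesis by (simp add: C_def b_def field_simps)
  qed
  have contW: "continuous_on {0..1} W"
    unfolding W_def using K(1) contH
    by (intro bounded_bilinear.continuous_on[OF bounded_bilinear_matrix_mult])
  have W0: "W 0 = mat 1" using XH Y(2) by (simp add: W_def)
  have "norm (W 0) \<le> 2" using norm_mat2_le[of "W 0"] by (simp add: W0 mat2_nth)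
  have "norm (W 1 - W 0) \<le> C * (1 - 0) * exp (C * (1 - 0)) * norm (W 0)"
    by (rule gronwall_deviation[OF K(2) _ C contW dW le]) simp_all
  also have "\<dots> \<le> C * (1 - 0) * exp (C * (1 - 0)) * 2"
    using \<open>norm (W 0) \<le> 2\<close> C by (intro mult_left_mono) auto
  finally have dev: "norm (W 1 - W 0) \<le> 2 * (C * exp C)" by simp
  have "trace T = trace ((T ** H 0) ** X)" using XH by (simp flip: matrix_mul_assoc)
  also have "\<dots> = trace (X ** (T ** H 0))" by (rule trace_mul_sym)
  finally have trT: "trace T = trace (X ** (T ** H 0))" .
  define E where "E x = exp (2 * of_real pi * \<i> * of_real x)" for x :: real
  have eE: "e x 1 * E x = 1" for x unfolding E_def by (rule e1)
  \<comment> \<open>The monodromy of the Euler equation, from which the traces of the limit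
    come.\<close>
  have "H 0 = H 1 ** diag2 (E r1) (E r2)"
    by (simp add: mat2_simps H_def diag2_nth \<zeta>0 e0 eE mult.assoc)
  then have "X ** (T ** H 0) = W 1 ** diag2 (E r1) (E r2)"
    by (simp add: W_def Y1 matrix_mul_assoc)
  then have "trace T = W 1 $ 1 $ 1 * E r1 + W 1 $ 2 $ 2 * E r2"
    unfolding trT by (simp add: trace_2 mat2_mult_nth diag2_nth)
  then have "trace T - (E r1 + E r2) = (W 1 - W 0) $ 1 $ 1 * E r1 + (W 1 - W 0) $ 2 $ 2 * E r2"
    by (simp add: W0 mat2_nth algebra_simps)
  then have "norm (trace T - (E r1 + E r2)) \<le> norm ((W 1 - W 0) $ 1 $ 1 * E r1) + norm ((W 1 - W 0) $ 2 $ 2 * E r2)"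
    by (simp only: norm_triangle_ineq)
  also have "\<dots> = norm ((W 1 - W 0) $ 1 $ 1) + norm ((W 1 - W 0) $ 2 $ 2)"
    by (simp only: norm_mult) (simp add: E_def)
  also have "\<dots> \<le> 2 * (2 * (C * exp C))"
    using dev norm_mat2_nth_le[of "W 1 - W 0" 1 1] norm_mat2_nth_le[of "W 1 - W 0" 2 2] by linarith
  also have "\<dots> \<le> 8 * (C * exp C)" using C by simp
  finally show ?thesis unfolding E_def C_def .
qed

text \<open>The bound for the trace does not involve the radius, so circles with \<delta>
  \<rightarrow> 0 and a common trace \<tau> determine \<tau>. Since r1 = 1 - r2, the two
  exponentials are conjugate and add up to a cosine.\<close>

lemma circle_trace_eq:
  fixes q :: "complex \<Rightarrow> complex" and lam c \<tau> :: complex and r1 r2 :: real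
  defines "A \<equiv> \<lambda>z. vector [vector [0, inverse lam], vector [q z, 0]] :: cmat2"
  assumes nz: "lam \<noteq> 0" and r: "r1 + r2 = 1" "r1 \<noteq> r2"
    and circles: "\<And>\<delta>. \<delta> > 0 \<Longrightarrow> \<exists>\<rho> T. \<rho> \<noteq> 0 \<and> transport A (circle c \<rho>) 0 1 T \<and> trace T = \<tau> \<and>
      (\<forall>t. norm (inverse lam * q (circle c \<rho> t) * (circle c \<rho> t - c)\<^sup>2 + of_real (r1 * r2)) \<le> \<delta>)"
  shows "\<tau> = of_real (2 * cos (2 * pi * r2))"
proof -
  let ?E = "exp (2 * of_real pi * \<i> * of_real r1) + exp (2 * of_real pi * \<i> * of_real r2)"
  let ?b = "\<lambda>\<delta>. 8 * (16 * pi / \<bar>r1 - r2\<bar> * \<delta> * exp (16 * pi / \<bar>r1 - r2\<bar> * \<delta>))"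
  have "norm (\<tau> - ?E) \<le> ?b \<delta>" if \<delta>: "\<delta> > 0" for \<delta>
  proof -
    obtain \<rho> T where "\<rho> \<noteq> 0" "transport A (circle c \<rho>) 0 1 T" "trace T = \<tau>"
      "\<And>t. norm (inverse lam * q (circle c \<rho> t) * (circle c \<rho> t - c)\<^sup>2 + of_real (r1 * r2)) \<le> \<delta>"
      using circles[OF \<delta>] by blast
    then show ?thesis
      using circle_trace_bound[of lam q c \<rho> T r1 r2 \<delta>] nz r \<delta> unfolding A_def by simp
  qed
  moreover have "(?b \<longlongrightarrow> 8 * (16 * pi / \<bar>r1 - r2\<bar> * 0 * exp (16 * pi / \<bar>r1 - r2\<bar> * 0))) (at_right 0)"
    by (intro tendsto_intros)
  then have "(?b \<longlongrightarrow> 0) (at_right 0)" by simp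
  ultimately have "norm (\<tau> - ?E) \<le> 0"
    by (intro tendsto_lowerbound[of ?b _ "at_right 0"])
      (auto simp: eventually_at_right_less intro: eventually_mono[OF eventually_at_right_less])
  then have "\<tau> = ?E" by simp
  also have "\<dots> = of_real (2 * cos (2 * pi * r2))"
  proof -
    have "exp (2 * of_real pi * \<i> * of_real r1) = cis (2 * pi * r1)"
        "exp (2 * of_real pi * \<i> * of_real r2) = cis (2 * pi * r2)"
      by (simp_all add: cis_conv_exp mult_ac)
    moreover have r1: "r1 = 1 - r2" using r by simp
    have "2 * pi * r1 = 2 * pi - 2 * pi * r2" unfolding r1 by (simp add: algebra_simps)
    ultimately show ?thesis by (simp add: complex_eq_iff cos_diff sin_diff)
  qed
  finally show ?thesis .
qed

section \<open>The monodromy of the trinoid potential\<close>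

definition far_ray :: "complex set" where
  "far_ray = {v. Im v = 0 \<and> 1 \<le> Re v}"

text \<open>The plane slit along the rays that point away from \<open>p\<close> and start at 0 and at 1: it is
  star-shaped about \<open>p\<close>, and it contains the closed half plane of \<open>p\<close> except for 0 and 1.\<close>
definition slit_plane :: "complex \<Rightarrow> complex set" where
  "slit_plane p = {z. \<forall>a\<in>{0, 1}. (z - p) * inverse (a - p) \<notin> far_ray}"

lemma open_slit_plane: "open (slit_plane p)"
proof -
  have "closed far_ray"
    unfolding far_ray_def
    by (intro closed_Collect_conj closed_Collect_eq closed_Collect_le continuous_intros)
  then have "open ((\<lambda>z. (z - p) * inverse (a - p)) -` (- far_ray))" for a
    by (intro open_vimage open_Compl continuous_intros)
  moreover have "slit_plane p = (\<lambda>z. (z - p) * inverse (0 - p)) -` (- far_ray) \<inter>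
      (\<lambda>z. (z - p) * inverse (1 - p)) -` (- far_ray)"
    unfolding slit_plane_def by blast
  ultimately show ?thesis by (simp only: open_Int)
qed

lemma slit_plane_starlike:
  assumes "z \<in> slit_plane p"
  shows "closed_segment p z \<subseteq> slit_plane p"
proof
  fix w assume "w \<in> closed_segment p z"
  then obtain u where u: "0 \<le> u" "u \<le> 1" "w = (1 - u) *\<^sub>R p + u *\<^sub>R z" by (auto simp: closed_segment_def)
  have "w - p = of_real u * (z - p)"
    using u(3) by (simp add: scaleR_conv_of_real algebra_simps)
  then have eq: "(w - p) * inverse (a - p) = of_real u * ((z - p) * inverse (a - p))" for a
    by simp
  have "(w - p) * inverse (a - p) \<notin> far_ray" if a: "a \<in> {0, 1}" for a
  proof
    define v where "v = (z - p) * inverse (a - p)"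
    assume "(w - p) * inverse (a - p) \<in> far_ray"
    then have v: "u * Im v = 0" "1 \<le> u * Re v" unfolding eq v_def[symmetric] by (simp_all add: far_ray_def)
    then have "u \<noteq> 0" by auto
    then have "Im v = 0" using v by simp
    moreover have "1 \<le> Re v"
    proof (rule ccontr)
      assume "\<not> 1 \<le> Re v"
      then have "u * Re v < u * 1" using u \<open>u \<noteq> 0\<close> by (intro mult_strict_left_mono) auto
      then show False using v u by simp
    qed
    ultimately have "v \<in> far_ray" by (simp add: far_ray_def)
    then show False using assms a unfolding slit_plane_def v_def by blast
  qed
  then show "w \<in> slit_plane p" unfolding slit_plane_def by blast
qed

lemma centre_in_slit_plane: "p \<in> slit_plane p"
  by (simp add: slit_plane_def far_ray_def)

text \<open>Seen from p, the slit behind a real point a lies in the opposite open half plane, except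
  for a itself.\<close>

lemma halfplane_in_slit_plane:
  assumes "Im p \<noteq> 0" "Im z * Im p \<ge> 0" "z \<noteq> 0" "z \<noteq> 1"
  shows "z \<in> slit_plane p"
proof -
  have "(z - p) * inverse (a - p) \<notin> far_ray" if a: "a \<in> {0, 1}" for a
  proof
    assume ray: "(z - p) * inverse (a - p) \<in> far_ray"
    define k where "k = Re ((z - p) * inverse (a - p))"
    have k: "(z - p) * inverse (a - p) = of_real k" "1 \<le> k"
      using ray unfolding far_ray_def by (simp_all add: k_def complex_eq_iff del: times_complex.simps inverse_complex.simps)
    have ap: "a - p \<noteq> 0" using a assms(1) by auto
    have z: "z = p + of_real k * (a - p)" using k(1) ap by (simp add: field_simps)
    have "Im a = 0" using a by auto
    then have "Im z = Im p * (1 - k)" unfolding z by (simp add: algebra_simps)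
    then have "(Im p)\<^sup>2 * (1 - k) \<ge> 0" using assms(2) by (simp add: mult_ac power2_eq_square)
    then have "k \<le> 1" using assms(1) by (simp add: zero_le_mult_iff)
    then have "z = a" using k(2) z by simp
    then show False using a assms by auto
  qed
  then show ?thesis unfolding slit_plane_def by blast
qed

lemma slit_plane_avoids:
  assumes "z \<in> slit_plane p" "Im p \<noteq> 0"
  shows "z \<noteq> 0" "z \<noteq> 1"
proof -
  have "a \<notin> slit_plane p" if "a \<in> {0, 1}" for a
  proof -
    have "a - p \<noteq> 0" using that assms(2) by auto
    then have "(a - p) * inverse (a - p) = 1" by (rule right_inverse)
    then have "(a - p) * inverse (a - p) \<in> far_ray" unfolding far_ray_def by simp
    then show ?thesis using that unfolding slit_plane_def by blast
  qed
  then show "z \<noteq> 0" "z \<noteq> 1" using assms(1) by auto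
qed

lemma trinoid_fundamental_exists:
  assumes "Im p \<noteq> 0"
  obtains F where "fundamental_on (trinoid_pot w1 w2 w3 lam) (slit_plane p) F"
proof -
  have hol: "(\<lambda>z. trinoid_pot w1 w2 w3 lam z $ i $ j) holomorphic_on slit_plane p" for i j :: 2
  proof -
    have "QW w1 w2 w3 holomorphic_on slit_plane p"
      unfolding QW_def[abs_def] using slit_plane_avoids assms by (intro holomorphic_intros) auto
    then show ?thesis
      using exhaust_2[of i] exhaust_2[of j]
      by (auto simp: trinoid_pot_def intro!: holomorphic_intros)
  qed
  have tr: "trace (trinoid_pot w1 w2 w3 lam z) = 0" for z by (simp add: trace_2 trinoid_pot_def)
  show thesis
    by (rule fundamental_on_starlike_exists[OF open_slit_plane centre_in_slit_plane
          slit_plane_starlike hol tr that])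
qed

section \<open>Circles and the three loops in the slit planes\<close>

lemma circle_cis: "circle c \<rho> t = c + \<rho> * cis (2 * pi * t)"
  by (simp add: circle_def cis_conv_exp mult_ac)

lemma circle_0_1: "circle c \<rho> 0 = c + \<rho>" "circle c \<rho> 1 = c + \<rho>" "circle c \<rho> (1/2) = c - \<rho>"
  by (simp_all add: circle_cis)

lemma Im_circle: "Im c = 0 \<Longrightarrow> Im (circle c (of_real \<rho>) t) = \<rho> * sin (2 * pi * t)"
  by (simp add: circle_cis)

lemma norm_circle: "norm (circle c \<rho> t - c) = norm \<rho>"
  by (simp add: circle_def norm_mult)

lemma sin_2pi_nonneg: "0 \<le> t \<Longrightarrow> t \<le> 1/2 \<Longrightarrow> sin (2 * pi * t) \<ge> 0"
  by (intro sin_ge_zero) auto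

lemma sin_2pi_nonpos: 
  assumes "1/2 \<le> t" "t \<le> 1"
  shows "sin (2 * pi * t) \<le> 0"
proof -
  have "sin (2 * pi * (t - 1/2)) \<ge> 0" using assms by (intro sin_2pi_nonneg) auto
  moreover have "2 * pi * (t - 1/2) = 2 * pi * t - pi" by (simp add: algebra_simps)
  ultimately show ?thesis by (simp add: sin_diff)
qed

lemma continuous_on_circle: "continuous_on A (circle c \<rho>)"
  unfolding circle_def by (intro continuous_intros)

lemma differentiable_circle: "circle c \<rho> differentiable at t"
  using circle_has_vector_derivative differentiableI_vector by blast

text \<open>The sign conditions say that the first half of the circle lies in the closed half plane
  of p and the second half in that of p'. A radius different from 1 in modulus avoids the other
  puncture.\<close>

lemma circle_transport:
  fixes \<rho> :: real
  assumes F: "fundamental_on A (slit_plane p) F" "\<rho> * Im p > 0"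
    and G: "fundamental_on A (slit_plane p') G" "\<rho> * Im p' < 0"
    and c: "c \<in> {0, 1}" and \<rho>: "\<bar>\<rho>\<bar> \<noteq> 1"
  shows "transport A (circle c (of_real \<rho>)) 0 1
     ((adj2 (F (c + of_real \<rho>)) ** F (c - of_real \<rho>)) ** (adj2 (G (c - of_real \<rho>)) ** G (c + of_real \<rho>)))"
proof -
  let ?g = "circle c (of_real \<rho>)"
  have \<rho>0: "\<rho> \<noteq> 0" using F(2) by auto
  have ne: "?g t \<noteq> 0" "?g t \<noteq> 1" for t
  proof -
    have n: "norm (?g t - c) \<noteq> 0" "norm (?g t - c) \<noteq> 1" using norm_circle[of c "of_real \<rho>" t] \<rho> \<rho>0 by auto
    show "?g t \<noteq> 0" "?g t \<noteq> 1" using n c by auto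
  qed
  have im: "Im (?g t) = \<rho> * sin (2 * pi * t)" for t using c by (intro Im_circle) auto
  have in1: "?g ` {0..1/2} \<subseteq> slit_plane p"
  proof clarify
    fix t :: real assume t: "t \<in> {0..1/2}"
    have "(\<rho> * Im p) * sin (2 * pi * t) \<ge> 0"
      using F(2) sin_2pi_nonneg[of t] t by (intro mult_nonneg_nonneg[of "\<rho> * Im p"]) auto
    then have "Im (?g t) * Im p \<ge> 0" by (simp only: im mult_ac)
    moreover have "Im p \<noteq> 0" using F(2) by auto
    ultimately show "?g t \<in> slit_plane p" using ne by (intro halfplane_in_slit_plane)
  qed
  have in2: "?g ` {1/2..1} \<subseteq> slit_plane p'"
  proof clarify
    fix t :: real assume t: "t \<in> {1/2..1}"
    have "(\<rho> * Im p') * sin (2 * pi * t) \<ge> 0"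
      using G(2) sin_2pi_nonpos[of t] t by (intro mult_nonpos_nonpos[of "\<rho> * Im p'"]) auto
    then have "Im (?g t) * Im p' \<ge> 0" by (simp only: im mult_ac)
    moreover have "Im p' \<noteq> 0" using G(2) by auto
    ultimately show "?g t \<in> slit_plane p'" using ne by (intro halfplane_in_slit_plane)
  qed
  have "transport A ?g 0 (1/2) (adj2 (F (?g 0)) ** F (?g (1/2)))"
    by (rule transport_fundamental[OF F(1) _ continuous_on_circle in1 finite.emptyI differentiable_circle]) simp
  moreover have "transport A ?g (1/2) 1 (adj2 (G (?g (1/2))) ** G (?g 1))"
    by (rule transport_fundamental[OF G(1) _ continuous_on_circle in2 finite.emptyI differentiable_circle]) simp
  ultimately have "transport A ?g 0 1 ((adj2 (F (?g 0)) ** F (?g (1/2))) ** (adj2 (G (?g (1/2))) ** G (?g 1)))"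
    by (intro transport_join[of 0 "1/2" 1]) auto
  then show ?thesis unfolding circle_0_1 .
qed

lemma loop_eq_circle: "loop0 = circle 0 (of_real (1/2))" "loop1 = circle 1 (of_real (-1/2))"
  by (auto simp: loop0_def loop1_def circle_def)

lemma loopinf_eq: "loopinf t = (if t \<ge> 1/2 then loop0 (2 - 2 * t) else loop1 (1 - 2 * t))"
proof -
  have "2 * (1 - t) = 2 - 2 * t" "2 * (1 - t) - 1 = 1 - 2 * t" "1 - t \<le> 1/2 \<longleftrightarrow> t \<ge> 1/2" by auto
  then show ?thesis unfolding loopinf_def reversepath_def joinpaths_def by (simp only:)
qed

lemma continuous_on_loopinf: "continuous_on {0..1} loopinf"
proof -
  have "path loop0" "path loop1" by (simp_all add: path_def loop_eq_circle continuous_on_circle)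
  moreover have "pathfinish loop0 = pathstart loop1"
    by (simp add: pathfinish_def pathstart_def loop_eq_circle circle_0_1)
  ultimately have "path loopinf" unfolding loopinf_def by simp
  then show ?thesis by (simp add: path_def)
qed

lemma differentiable_loopinf:
  assumes "t \<noteq> 1/2"
  shows "loopinf differentiable at t"
proof -
  have d: "(\<lambda>t. circle c \<rho> (a - 2 * t)) differentiable at t" for a c \<rho>
  proof -
    have "(circle c \<rho> \<circ> (\<lambda>t. a - 2 * t)) differentiable at t"
      by (intro differentiable_chain_at differentiable_circle) (auto intro!: derivative_intros)
    then show ?thesis by (simp add: o_def)
  qed
  show ?thesis
  proof (cases "t > 1/2")
    case True
    have "(\<lambda>t. loop0 (2 - 2 * t)) differentiable at t" unfolding loop_eq_circle by (rule d)
    then obtain D where "((\<lambda>t. loop0 (2 - 2 * t)) has_derivative D) (at t)" unfolding differentiable_def by blast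
    then have "(loopinf has_derivative D) (at t)"
      by (rule has_derivative_transform_within_open[where s = "{1/2<..}"]) (use True in \<open>auto simp: loopinf_eq\<close>)
    then show ?thesis unfolding differentiable_def by blast
  next
    case False
    have "(\<lambda>t. loop1 (1 - 2 * t)) differentiable at t" unfolding loop_eq_circle by (rule d)
    then obtain D where "((\<lambda>t. loop1 (1 - 2 * t)) has_derivative D) (at t)" unfolding differentiable_def by blast
    then have "(loopinf has_derivative D) (at t)"
      by (rule has_derivative_transform_within_open[where s = "{..<1/2}"]) (use False assms in \<open>auto simp: loopinf_eq\<close>)
    then show ?thesis unfolding differentiable_def by blast
  qed
qed

lemma loopinf_ne: "loopinf t \<noteq> 0" "loopinf t \<noteq> 1"
proof -
  have "loop0 s \<noteq> 0" "loop0 s \<noteq> 1" "loop1 s \<noteq> 0" "loop1 s \<noteq> 1" for s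
    using norm_circle[of 0 "of_real (1/2)" s] norm_circle[of 1 "of_real (-1/2)" s]
    unfolding loop_eq_circle by auto
  then show "loopinf t \<noteq> 0" "loopinf t \<noteq> 1" unfolding loopinf_eq by auto
qed

lemma Im_loopinf:
  "Im (loopinf t) = (if t \<ge> 1/2 then 1/2 * sin (2 * pi * (2 - 2 * t)) else - (1/2) * sin (2 * pi * (1 - 2 * t)))"
  unfolding loopinf_eq loop_eq_circle
  using Im_circle[of 0 "1/2" "2 - 2 * t"] Im_circle[of 1 "-1/2" "1 - 2 * t"] by simp

text \<open>The loop changes the half plane only at 3/2 (t = 1/4) and at -1/2 (t = 3/4). At t = 1/2,
  where the two circles meet in 1/2, it stays in the closed lower half plane and only has an
  exceptional point of the derivative.\<close>

lemma loopinf_transport: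
  assumes U: "fundamental_on A (slit_plane p) U" "Im p > 0"
    and L: "fundamental_on A (slit_plane p') L" "Im p' < 0"
  shows "transport A loopinf 0 1
     ((adj2 (U (1/2)) ** U (3/2)) ** (adj2 (L (3/2)) ** L (-1/2)) ** (adj2 (U (-1/2)) ** U (1/2)))"
proof -
  have up: "loopinf t \<in> slit_plane p" if "Im (loopinf t) \<ge> 0" for t
    using that U(2) loopinf_ne by (intro halfplane_in_slit_plane) auto
  have low: "loopinf t \<in> slit_plane p'" if "Im (loopinf t) \<le> 0" for t
    using that L(2) loopinf_ne by (intro halfplane_in_slit_plane) (auto simp: mult_nonpos_nonpos)
  have in1: "loopinf ` {0..1/4} \<subseteq> slit_plane p"
  proof clarify
    fix t :: real assume "t \<in> {0..1/4}"
    then show "loopinf t \<in> slit_plane p"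
      using sin_2pi_nonpos[of "1 - 2 * t"] by (intro up) (simp add: Im_loopinf)
  qed
  have in2: "loopinf ` {1/4..3/4} \<subseteq> slit_plane p'"
  proof clarify
    fix t :: real assume "t \<in> {1/4..3/4}"
    then show "loopinf t \<in> slit_plane p'"
      using sin_2pi_nonneg[of "1 - 2 * t"] sin_2pi_nonpos[of "2 - 2 * t"] by (intro low) (simp add: Im_loopinf)
  qed
  have in3: "loopinf ` {3/4..1} \<subseteq> slit_plane p"
  proof clarify
    fix t :: real assume "t \<in> {3/4..1}"
    then show "loopinf t \<in> slit_plane p"
      using sin_2pi_nonneg[of "2 - 2 * t"] by (intro up) (simp add: Im_loopinf)
  qed
  have vals: "loopinf 0 = 1/2" "loopinf (1/4) = 3/2" "loopinf (3/4) = -1/2" "loopinf 1 = 1/2"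
    by (simp_all add: loopinf_eq loop_eq_circle circle_0_1)
  have cont: "continuous_on {a..b} loopinf" if "0 \<le> a" "b \<le> 1" for a b
    using continuous_on_loopinf by (rule continuous_on_subset) (use that in auto)
  have 1: "transport A loopinf 0 (1/4) (adj2 (U (loopinf 0)) ** U (loopinf (1/4)))"
    by (rule transport_fundamental[OF U(1) _ cont in1, of "{1/2}"]) (auto intro: differentiable_loopinf)
  have 2: "transport A loopinf (1/4) (3/4) (adj2 (L (loopinf (1/4))) ** L (loopinf (3/4)))"
    by (rule transport_fundamental[OF L(1) _ cont in2, of "{1/2}"]) (auto intro: differentiable_loopinf)
  have 3: "transport A loopinf (3/4) 1 (adj2 (U (loopinf (3/4))) ** U (loopinf 1))"
    by (rule transport_fundamental[OF U(1) _ cont in3, of "{1/2}"]) (auto intro: differentiable_loopinf)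
  show ?thesis
    using transport_join[OF _ _ transport_join[OF _ _ 1 2] 3] unfolding vals by simp
qed

text \<open>The real segment from x to y lies in both slit planes, so both fundamental solutions
  compute the same transport along it.\<close>

lemma transport_cross_eq:
  fixes x y :: real
  assumes U: "fundamental_on A (slit_plane p) U" "Im p \<noteq> 0"
    and L: "fundamental_on A (slit_plane p') L" "Im p' \<noteq> 0"
    and xy: "x < 0 \<and> y < 0 \<or> 0 < x \<and> x < 1 \<and> 0 < y \<and> y < 1 \<or> 1 < x \<and> 1 < y"
  shows "U (of_real x) ** adj2 (L (of_real x)) = U (of_real y) ** adj2 (L (of_real y))"
proof -
  define g where "g t = complex_of_real ((1 - t) * x + t * y)" for t
  have ne: "(1 - t) * x + t * y \<noteq> 0 \<and> (1 - t) * x + t * y \<noteq> 1" if t: "0 \<le> t" "t \<le> 1" for t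
    using xy
  proof (elim disjE conjE)
    assume "x < 0" "y < 0"
    then show ?thesis using convex_bound_lt[of x 0 y "1 - t" t] t by simp
  next
    assume "0 < x" "x < 1" "0 < y" "y < 1"
    then show ?thesis using convex_bound_lt[of x 1 y "1 - t" t] convex_bound_lt[of "-x" 0 "-y" "1 - t" t] t by simp
  next
    assume "1 < x" "1 < y"
    then show ?thesis
      using convex_bound_lt[of "-x" "-1" "-y" "1 - t" t] t by simp
  qed
  have inS: "g ` {0..1} \<subseteq> slit_plane p''" if "Im p'' \<noteq> 0" for p''
  proof clarify
    fix t :: real assume t: "t \<in> {0..1}"
    have "g t \<noteq> 0" "g t \<noteq> 1" using ne[of t] t unfolding g_def of_real_eq_0_iff of_real_eq_1_iff by auto
    moreover have "Im (g t) * Im p'' \<ge> 0" unfolding g_def by simp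
    ultimately show "g t \<in> slit_plane p''" using that by (intro halfplane_in_slit_plane)
  qed
  have cont: "continuous_on {0..1} g" unfolding g_def by (intro continuous_intros)
  have diff: "g differentiable at t" for t
  proof -
    have "((\<lambda>t. (1 - t) * x + t * y) has_vector_derivative (y - x)) (at t)"
      by (auto intro!: derivative_eq_intros simp: has_vector_derivative_def algebra_simps)
    then have "(g has_vector_derivative of_real (y - x)) (at t)"
      unfolding g_def by (rule bounded_linear.has_vector_derivative[OF bounded_linear_of_real])
    then show ?thesis by (rule differentiableI_vector)
  qed
  have g01: "g 0 = of_real x" "g 1 = of_real y" by (simp_all add: g_def)
  have tU: "transport A g 0 1 (adj2 (U (of_real x)) ** U (of_real y))"
    using transport_fundamental[OF U(1) _ cont inS[OF U(2)] finite.emptyI diff] unfolding g01 by simp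
  have tL: "transport A g 0 1 (adj2 (L (of_real x)) ** L (of_real y))"
    using transport_fundamental[OF L(1) _ cont inS[OF L(2)] finite.emptyI diff] unfolding g01 by simp
  have "g 0 \<in> slit_plane p" "g 1 \<in> slit_plane p'"
    using subsetD[OF inS[OF U(2)], of "g 0"] subsetD[OF inS[OF L(2)], of "g 1"] by simp_all
  then have "of_real x \<in> slit_plane p" "of_real y \<in> slit_plane p'" unfolding g01 .
  then have det: "det (U (of_real x)) = 1" "det (L (of_real y)) = 1"
    using U(1) L(1) unfolding fundamental_on_def by auto
  have "U (of_real y) ** adj2 (L (of_real y)) =
      U (of_real x) ** (adj2 (U (of_real x)) ** U (of_real y)) ** adj2 (L (of_real y))"
    using det(1) by (simp add: mult_adj2 matrix_mul_assoc)
  also have "\<dots> = U (of_real x) ** (adj2 (L (of_real x)) ** L (of_real y)) ** adj2 (L (of_real y))"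
    unfolding transport_unique[OF tU tL] ..
  also have "\<dots> = U (of_real x) ** adj2 (L (of_real x))"
    using det(2) by (simp add: mult_adj2 flip: matrix_mul_assoc)
  finally show ?thesis ..
qed

text \<open>The numerator of Q has the value w1 at 0, the value w2 at 1 and the leading coefficient
  w3.\<close>

lemma QW_tendsto:
  "((\<lambda>z. z\<^sup>2 * QW w1 w2 w3 z) \<longlongrightarrow> of_real (w1 / 16)) (at 0)"
  "((\<lambda>z. (z - 1)\<^sup>2 * QW w1 w2 w3 z) \<longlongrightarrow> of_real (w2 / 16)) (at 1)"
  "((\<lambda>z. z\<^sup>2 * QW w1 w2 w3 z) \<longlongrightarrow> of_real (w3 / 16)) at_infinity"
proof -
  let ?N = "\<lambda>z. of_real w3 * z\<^sup>2 - of_real (w1 - w2 + w3) * z + of_real w1 :: complex"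
  have "((\<lambda>z. ?N z / (16 * (z - 1)\<^sup>2)) \<longlongrightarrow> ?N 0 / (16 * (0 - 1)\<^sup>2)) (at 0)"
    by (intro tendsto_intros) auto
  moreover have "eventually (\<lambda>z. ?N z / (16 * (z - 1)\<^sup>2) = z\<^sup>2 * QW w1 w2 w3 z) (at 0)"
    unfolding eventually_at_filter by (rule always_eventually) (simp add: QW_def)
  ultimately show "((\<lambda>z. z\<^sup>2 * QW w1 w2 w3 z) \<longlongrightarrow> of_real (w1 / 16)) (at 0)"
    by (auto dest: Lim_transform_eventually)
  have "((\<lambda>z. ?N z / (16 * z\<^sup>2)) \<longlongrightarrow> ?N 1 / (16 * 1\<^sup>2)) (at 1)"
    by (intro tendsto_intros) auto
  moreover have "eventually (\<lambda>z. ?N z / (16 * z\<^sup>2) = (z - 1)\<^sup>2 * QW w1 w2 w3 z) (at 1)"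
    unfolding eventually_at_filter by (rule always_eventually) (simp add: QW_def)
  ultimately show "((\<lambda>z. (z - 1)\<^sup>2 * QW w1 w2 w3 z) \<longlongrightarrow> of_real (w2 / 16)) (at 1)"
    by (auto dest: Lim_transform_eventually)
  let ?P = "\<lambda>u. of_real w3 - of_real (w1 - w2 + w3) * u + of_real w1 * u\<^sup>2 :: complex"
  have "((\<lambda>u. ?P u / (16 * (1 - u)\<^sup>2)) \<longlongrightarrow> ?P 0 / (16 * (1 - 0)\<^sup>2)) (at 0)"
    by (intro tendsto_intros) auto
  moreover have "?P u / (16 * (1 - u)\<^sup>2) = (inverse u)\<^sup>2 * QW w1 w2 w3 (inverse u)" if "u \<noteq> 0" for u
  proof -
    have eqs: "?N (inverse u) = ?P u / u\<^sup>2" "inverse u - 1 = (1 - u) / u"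
      using that by (simp_all add: field_simps power2_eq_square)
    have "n / (16 * b) = inverse a * ((n / a) / (16 * inverse a * (b / a)))" if "a \<noteq> 0" for n a b :: complex
      using that by (cases "b = 0") (simp_all add: field_simps)
    from this[of "u\<^sup>2" "?P u" "(1 - u)\<^sup>2"] that have "?P u / (16 * (1 - u)\<^sup>2)
        = (inverse u)\<^sup>2 * ((?P u / u\<^sup>2) / (16 * (inverse u)\<^sup>2 * ((1 - u) / u)\<^sup>2))"
      unfolding power_divide power_inverse by simp
    then show ?thesis unfolding QW_def eqs .
  qed
  then have "eventually (\<lambda>u. ?P u / (16 * (1 - u)\<^sup>2) = (inverse u)\<^sup>2 * QW w1 w2 w3 (inverse u)) (at 0)"
    unfolding eventually_at_filter by (intro always_eventually) blast
  ultimately have "((\<lambda>u. (inverse u)\<^sup>2 * QW w1 w2 w3 (inverse u)) \<longlongrightarrow> of_real (w3 / 16)) (at 0)"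
    by (auto dest: Lim_transform_eventually)
  then show "((\<lambda>z. z\<^sup>2 * QW w1 w2 w3 z) \<longlongrightarrow> of_real (w3 / 16)) at_infinity"
    unfolding lim_at_infinity_0 o_def .
qed

section \<open>Traces of the monodromies for lambda on the unit circle\<close>

lemma unit_circle_param:
  fixes lam :: complex
  assumes "norm lam = 1"
  shows "inverse lam * (lam - 1)\<^sup>2 = of_real (- 4 * ((1 - Re lam) / 2))"
    and "0 \<le> (1 - Re lam) / 2" "(1 - Re lam) / 2 \<le> 1"
proof -
  have "lam \<noteq> 0" using assms by auto
  have "lam * cnj lam = 1" using complex_norm_square[of lam] assms by simp
  then have "inverse lam = cnj lam" using \<open>lam \<noteq> 0\<close> by (simp add: field_simps)
  then have "inverse lam * (lam - 1)\<^sup>2 = (lam * cnj lam) * lam - 2 * (lam * cnj lam) + cnj lam"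
    by (simp add: power2_eq_square algebra_simps)
  also have "\<dots> = lam + cnj lam - 2" using \<open>lam * cnj lam = 1\<close> by simp
  also have "\<dots> = of_real (- 4 * ((1 - Re lam) / 2))" by (simp add: complex_eq_iff)
  finally show "inverse lam * (lam - 1)\<^sup>2 = of_real (- 4 * ((1 - Re lam) / 2))" .
  show "0 \<le> (1 - Re lam) / 2" "(1 - Re lam) / 2 \<le> 1"
    using abs_Re_le_cmod[of lam] assms by auto
qed

lemma nn_mult: "v \<le> 1 \<Longrightarrow> (1 - nn v) * nn v = v / 4"
  by (simp add: nn_def field_simps)

text \<open>The transport around a circle alternates between two fundamental solutions; cyclic
  invariance groups the factors into their jumps at the two crossings of the real axis.\<close>

lemma trace_cyclic_adj2:
  "trace ((adj2 P ** Q) ** (adj2 R ** V)) = trace ((Q ** adj2 R) ** adj2 (P ** adj2 V))"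
proof -
  have "trace ((adj2 P ** Q) ** (adj2 R ** V)) = trace (adj2 P ** (Q ** adj2 R ** V))"
    by (simp add: matrix_mul_assoc)
  also have "\<dots> = trace ((Q ** adj2 R ** V) ** adj2 P)" by (rule trace_mul_sym)
  finally show ?thesis by (simp add: adj2_mult matrix_mul_assoc)
qed

locale trinoid_unit_circle =
  fixes w1 w2 w3 :: real and lam :: complex
  assumes w: "w1 < 1" "w2 < 1" "w3 < 1" and lam: "norm lam = 1"
begin

definition s where "s = (1 - Re lam) / 2"

lemma s: "0 \<le> s" "s \<le> 1" "inverse lam * (lam - 1)\<^sup>2 = of_real (- 4 * s)"
  using unit_circle_param[OF lam] by (simp_all add: s_def)

abbreviation A where "A \<equiv> trinoid_pot w1 w2 w3 lam"

text \<open>In the limit the coefficient is -4 s v / 16, which cancels against nu (1 - nu) = s v /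
  4. Only values on circles enter, so c = 0 with large radii covers the puncture at
  infinity.\<close>

lemma trace_eq_by_circles:
  assumes v: "v < 1"
    and circles: "\<And>\<delta>. \<delta> > 0 \<Longrightarrow> \<exists>\<rho> T. \<rho> \<noteq> 0 \<and> transport A (circle c \<rho>) 0 1 T \<and> trace T = \<tau> \<and>
      (\<forall>t. norm ((circle c \<rho> t - c)\<^sup>2 * QW w1 w2 w3 (circle c \<rho> t) - of_real (v / 16)) < \<delta>)"
  shows "\<tau> = of_real (2 * cos (2 * pi * nn (s * v)))"
proof (rule circle_trace_eq)
  have sv: "s * v < 1" using scaled_less_1[OF v s(1,2)] .
  show "lam \<noteq> 0" using lam by auto
  show "1 - nn (s * v) + nn (s * v) = 1" by simp
  show "1 - nn (s * v) \<noteq> nn (s * v)" using sv by (simp add: nn_def field_simps)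
  fix \<delta> :: real assume "\<delta> > 0"
  \<comment> \<open>The error of z^2 Q is multiplied by 4 s, which is at most 4.\<close>
  then have "\<delta> / 4 > 0" by simp
  then obtain \<rho> T where \<rho>: "\<rho> \<noteq> 0" "transport A (circle c \<rho>) 0 1 T" "trace T = \<tau>"
    and le: "\<And>t. norm ((circle c \<rho> t - c)\<^sup>2 * QW w1 w2 w3 (circle c \<rho> t) - of_real (v / 16)) < \<delta> / 4"
    using circles[of "\<delta> / 4"] by blast
  have "norm (inverse lam * ((lam - 1)\<^sup>2 * QW w1 w2 w3 (circle c \<rho> t)) * (circle c \<rho> t - c)\<^sup>2
      + of_real ((1 - nn (s * v)) * nn (s * v))) \<le> \<delta>" for t
  proof -
    let ?z = "circle c \<rho> t"
    let ?d = "(?z - c)\<^sup>2 * QW w1 w2 w3 ?z - of_real (v / 16)"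
    have n: "(1 - nn (s * v)) * nn (s * v) = s * v / 4" using nn_mult[of "s * v"] sv by simp
    have "inverse lam * ((lam - 1)\<^sup>2 * QW w1 w2 w3 ?z) * (?z - c)\<^sup>2
        = (inverse lam * (lam - 1)\<^sup>2) * ((?z - c)\<^sup>2 * QW w1 w2 w3 ?z)" by (simp only: mult_ac)
    also have "\<dots> + of_real (s * v / 4) = of_real (- 4 * s) * ?d"
      unfolding s(3) by (simp add: algebra_simps)
    finally have "norm (inverse lam * ((lam - 1)\<^sup>2 * QW w1 w2 w3 ?z) * (?z - c)\<^sup>2
        + of_real ((1 - nn (s * v)) * nn (s * v))) = norm (of_real (- 4 * s) * ?d)"
      unfolding n by (rule arg_cong)
    also have "\<dots> = (4 * s) * norm ?d" unfolding norm_mult norm_of_real using s by simp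
    also have "\<dots> \<le> 4 * (\<delta> / 4)" using s le[of t] by (intro mult_mono) auto
    finally show ?thesis by simp
  qed
  moreover have "A = (\<lambda>z. vector [vector [0, inverse lam], vector [(lam - 1)\<^sup>2 * QW w1 w2 w3 z, 0]])"
    by (simp add: fun_eq_iff trinoid_pot_def)
  ultimately show "\<exists>\<rho> T. \<rho> \<noteq> 0 \<and>
      transport (\<lambda>z. vector [vector [0, inverse lam], vector [(lam - 1)\<^sup>2 * QW w1 w2 w3 z, 0]]) (circle c \<rho>) 0 1 T \<and>
      trace T = \<tau> \<and> (\<forall>t. norm (inverse lam * ((lam - 1)\<^sup>2 * QW w1 w2 w3 (circle c \<rho> t)) * (circle c \<rho> t - c)\<^sup>2
      + of_real ((1 - nn (s * v)) * nn (s * v))) \<le> \<delta>)"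
    using \<rho> by (intro exI[of _ \<rho>] exI[of _ T]) simp
qed

text \<open>The jump \<open>C x\<close> between fundamental solutions \<open>U\<close>, \<open>L\<close> on the upper and lower half plane
  is constant on each of the three real intervals, and up to conjugation the monodromies are the
  quotients of these three constants.\<close>
lemma transports:
  obtains T0 T1 Ti where
    "transport A loop0 0 1 T0" "transport A loop1 0 1 T1" "transport A loopinf 0 1 Ti"
    "det T0 = 1" "det T1 = 1" "T0 ** T1 ** Ti = mat 1"
    "trace T0 = of_real (2 * cos (2 * pi * nn (s * w1)))"
    "trace T1 = of_real (2 * cos (2 * pi * nn (s * w2)))"
    "trace (T0 ** T1) = of_real (2 * cos (2 * pi * nn (s * w3)))"
proof -
  define p p' where "p = Complex (1/2) 1" "p' = Complex (1/2) (-1)"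
  have im: "Im p = 1" "Im p' = -1" by (simp_all add: p_p'_def)
  obtain U where U: "fundamental_on A (slit_plane p) U"
    using trinoid_fundamental_exists[of p w1 w2 w3 lam] im by auto
  obtain L where L: "fundamental_on A (slit_plane p') L"
    using trinoid_fundamental_exists[of p' w1 w2 w3 lam] im by auto
  define C where "C x = U (of_real x) ** adj2 (L (of_real x))" for x :: real
  have C_eq: "C x = C y"
    if "x < 0 \<and> y < 0 \<or> 0 < x \<and> x < 1 \<and> 0 < y \<and> y < 1 \<or> 1 < x \<and> 1 < y" for x y
    unfolding C_def using transport_cross_eq[OF U _ L _ that] im by simp
  have det: "det (U (of_real x)) = 1" "det (L (of_real x)) = 1" if "x \<noteq> 0" "x \<noteq> 1" for x :: real
  proof -
    have "of_real x \<in> slit_plane p" "of_real x \<in> slit_plane p'"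
      using that im by (auto intro!: halfplane_in_slit_plane)
    then show "det (U (of_real x)) = 1" "det (L (of_real x)) = 1"
      using U L unfolding fundamental_on_def by auto
  qed
  have up: "\<exists>T. transport A (circle c (of_real \<rho>)) 0 1 T \<and> trace T = trace (C (Re c - \<rho>) ** adj2 (C (Re c + \<rho>)))"
    if "c \<in> {0, 1}" "\<rho> > 0" "\<rho> \<noteq> 1" for c \<rho>
  proof -
    have c: "c + of_real \<rho> = of_real (Re c + \<rho>)" "c - of_real \<rho> = of_real (Re c - \<rho>)"
      using that by auto
    show ?thesis
      using circle_transport[OF U _ L _ that(1), of \<rho>] im that unfolding c
      by (intro exI conjI) (assumption | simp add: trace_cyclic_adj2 C_def)+
  qed
  \<comment> \<open>With negative radius the circle starts at its leftmost point and runs through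
    the lower half plane first, so U and L exchange their roles; the trace is still that of the same
    two jumps.\<close>
  have low: "\<exists>T. transport A (circle c (of_real (- \<rho>))) 0 1 T \<and> trace T = trace (C (Re c - \<rho>) ** adj2 (C (Re c + \<rho>)))"
    if "c \<in> {0, 1}" "\<rho> > 0" "\<rho> \<noteq> 1" for c \<rho>
  proof -
    have c: "c + of_real (- \<rho>) = of_real (Re c - \<rho>)" "c - of_real (- \<rho>) = of_real (Re c + \<rho>)"
      using that by auto
    let ?T = "(adj2 (L (of_real (Re c - \<rho>))) ** L (of_real (Re c + \<rho>))) **
        (adj2 (U (of_real (Re c + \<rho>))) ** U (of_real (Re c - \<rho>)))"
    have "transport A (circle c (of_real (- \<rho>))) 0 1 ?T"
      using circle_transport[OF L _ U _ that(1), of "- \<rho>"] im that unfolding c by simp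
    moreover have "trace ?T = trace (adj2 (C (Re c + \<rho>)) ** C (Re c - \<rho>))"
      unfolding trace_cyclic_adj2 by (simp add: C_def adj2_mult)
    ultimately show ?thesis
      using trace_mul_sym[of "adj2 (C (Re c + \<rho>))" "C (Re c - \<rho>)"] by (intro exI[of _ ?T]) simp
  qed
  define T0 where "T0 = (adj2 (U (1/2)) ** U (-1/2)) ** (adj2 (L (-1/2)) ** L (1/2))"
  define T1 where "T1 = (adj2 (L (1/2)) ** L (3/2)) ** (adj2 (U (3/2)) ** U (1/2))"
  define Ti where "Ti = (adj2 (U (1/2)) ** U (3/2)) ** (adj2 (L (3/2)) ** L (-1/2)) ** (adj2 (U (-1/2)) ** U (1/2))"
  have dets: "det (U (1/2)) = 1" "det (L (1/2)) = 1" "det (U (-1/2)) = 1" "det (L (-1/2)) = 1"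
      "det (U (3/2)) = 1" "det (L (3/2)) = 1" "det (U (- (1/2))) = 1" "det (L (- (1/2))) = 1"
    using det[of "1/2"] det[of "-1/2"] det[of "3/2"] by simp_all
  have t0: "transport A loop0 0 1 T0"
    using circle_transport[OF U _ L _, of "1/2" 0] im unfolding loop_eq_circle T0_def by simp
  have t1: "transport A loop1 0 1 T1"
    using circle_transport[OF L _ U _, of "-1/2" 1] im unfolding loop_eq_circle T1_def by simp
  have ti: "transport A loopinf 0 1 Ti"
    using loopinf_transport[OF U _ L] im unfolding Ti_def by simp
  have cancel: "adj2 P ** (P ** R) = R" "P ** (adj2 P ** R) = R" if "det P = 1" for P R :: cmat2
    using mult_adj2[OF that] by (simp_all add: matrix_mul_assoc)
  have T01: "T0 ** T1 = (adj2 (U (1/2)) ** U (-1/2)) ** (adj2 (L (-1/2)) ** L (3/2) ** adj2 (U (3/2)) ** U (1/2))"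
    unfolding T0_def T1_def by (simp add: matrix_mul_assoc[symmetric] cancel dets)
  have Cs: "C (1/2) = U (1/2) ** adj2 (L (1/2))" "C (-1/2) = U (-1/2) ** adj2 (L (-1/2))"
      "C (3/2) = U (3/2) ** adj2 (L (3/2))" by (simp_all add: C_def)
  have trT0: "trace T0 = trace (C (-1/2) ** adj2 (C (1/2)))"
    unfolding T0_def trace_cyclic_adj2 Cs ..
  have trT1: "trace T1 = trace (C (1/2) ** adj2 (C (3/2)))"
  proof -
    have "trace T1 = trace (adj2 (C (3/2)) ** C (1/2))"
      unfolding T1_def trace_cyclic_adj2 Cs by (simp add: adj2_mult)
    then show ?thesis using trace_mul_sym[of "adj2 (C (3/2))" "C (1/2)"] by simp
  qed
  \<comment> \<open>The jump at 1/2 cancels in the product. The remaining two are also the jumps for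
    a circle around 0 that encloses 1.\<close>
  have trT01: "trace (T0 ** T1) = trace (C (-1/2) ** adj2 (C (3/2)))"
  proof -
    have "trace (T0 ** T1) = trace (adj2 (U (1/2)) ** (U (-1/2) ** adj2 (L (-1/2)) ** L (3/2) ** adj2 (U (3/2)) ** U (1/2)))"
      unfolding T01 by (simp add: matrix_mul_assoc)
    also have "\<dots> = trace ((U (-1/2) ** adj2 (L (-1/2)) ** L (3/2) ** adj2 (U (3/2)) ** U (1/2)) ** adj2 (U (1/2)))"
      by (rule trace_mul_sym)
    also have "\<dots> = trace (C (-1/2) ** adj2 (C (3/2)))"
      unfolding Cs adj2_mult by (simp add: matrix_mul_assoc[symmetric] mult_adj2 dets)
    finally show ?thesis .
  qed
  show thesis
  proof (rule that[OF t0 t1 ti])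
    show "det T0 = 1" "det T1 = 1" unfolding T0_def T1_def det_mul det_adj2 dets by simp_all
    show "T0 ** T1 ** Ti = mat 1"
      unfolding T01 Ti_def by (simp add: matrix_mul_assoc[symmetric] cancel dets mult_adj2)
    show "trace T0 = of_real (2 * cos (2 * pi * nn (s * w1)))"
    proof (rule trace_eq_by_circles[OF w(1), of 0])
      fix \<delta> :: real assume "\<delta> > 0"
      then have "eventually (\<lambda>z. dist (z\<^sup>2 * QW w1 w2 w3 z) (of_real (w1 / 16)) < \<delta>) (at 0)"
        by (rule tendstoD[OF QW_tendsto(1)])
      then obtain d where d: "d > 0" "\<And>z. z \<noteq> 0 \<Longrightarrow> dist z 0 < d \<Longrightarrow>
          dist (z\<^sup>2 * QW w1 w2 w3 z) (of_real (w1 / 16)) < \<delta>"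
        unfolding eventually_at by auto
      \<comment> \<open>A radius below 1 makes the circle cross the real axis in the same intervals
        as \<open>loop0\<close>.\<close>
      define \<rho> where "\<rho> = min (d / 2) (1 / 2)"
      have \<rho>: "\<rho> > 0" "\<rho> < d" "\<rho> < 1" using d(1) by (auto simp: \<rho>_def)
      obtain T where T: "transport A (circle 0 (of_real \<rho>)) 0 1 T" "trace T = trace (C (Re 0 - \<rho>) ** adj2 (C (Re 0 + \<rho>)))"
        using up[of 0 \<rho>] \<rho> by auto
      have "trace T = trace T0"
        using T(2) C_eq[of "- \<rho>" "-1/2"] C_eq[of \<rho> "1/2"] \<rho> unfolding trT0 by simp
      moreover have "norm ((circle 0 (of_real \<rho>) t - 0)\<^sup>2 * QW w1 w2 w3 (circle 0 (of_real \<rho>) t) - of_real (w1 / 16)) < \<delta>" for t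
      proof -
        let ?z = "circle 0 (of_real \<rho>) t"
        have n: "norm ?z = \<rho>" using norm_circle[of 0 "of_real \<rho>" t] \<rho> by simp
        then have "?z \<noteq> 0" using \<rho> by auto
        moreover have "dist ?z 0 < d" using n \<rho> by simp
        ultimately have "dist (?z\<^sup>2 * QW w1 w2 w3 ?z) (of_real (w1 / 16)) < \<delta>" by (rule d(2))
        then show ?thesis by (simp only: dist_norm diff_zero)
      qed
      ultimately show "\<exists>\<rho> T. \<rho> \<noteq> 0 \<and> transport A (circle 0 \<rho>) 0 1 T \<and> trace T = trace T0 \<and>
          (\<forall>t. norm ((circle 0 \<rho> t - 0)\<^sup>2 * QW w1 w2 w3 (circle 0 \<rho> t) - of_real (w1 / 16)) < \<delta>)"
        using T(1) \<rho>(1) by (intro exI[of _ "of_real \<rho>"] exI[of _ T]) simp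
    qed
    show "trace T1 = of_real (2 * cos (2 * pi * nn (s * w2)))"
    proof (rule trace_eq_by_circles[OF w(2), of 1])
      fix \<delta> :: real assume "\<delta> > 0"
      then have "eventually (\<lambda>z. dist ((z - 1)\<^sup>2 * QW w1 w2 w3 z) (of_real (w2 / 16)) < \<delta>) (at 1)"
        by (rule tendstoD[OF QW_tendsto(2)])
      then obtain d where d: "d > 0" "\<And>z. z \<noteq> 1 \<Longrightarrow> dist z 1 < d \<Longrightarrow>
          dist ((z - 1)\<^sup>2 * QW w1 w2 w3 z) (of_real (w2 / 16)) < \<delta>"
        unfolding eventually_at by auto
      define \<rho> where "\<rho> = min (d / 2) (1 / 2)"
      have \<rho>: "\<rho> > 0" "\<rho> < d" "\<rho> < 1" using d(1) by (auto simp: \<rho>_def)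
      obtain T where T: "transport A (circle 1 (of_real (- \<rho>))) 0 1 T" "trace T = trace (C (Re 1 - \<rho>) ** adj2 (C (Re 1 + \<rho>)))"
        using low[of 1 \<rho>] \<rho> by auto
      have "trace T = trace T1"
        using T(2) C_eq[of "1 - \<rho>" "1/2"] C_eq[of "1 + \<rho>" "3/2"] \<rho> unfolding trT1 by simp
      moreover have "norm ((circle 1 (of_real (- \<rho>)) t - 1)\<^sup>2 * QW w1 w2 w3 (circle 1 (of_real (- \<rho>)) t) - of_real (w2 / 16)) < \<delta>" for t
      proof -
        let ?z = "circle 1 (of_real (- \<rho>)) t"
        have n: "norm (?z - 1) = \<rho>" using norm_circle[of 1 "of_real (- \<rho>)" t] \<rho> by simp
        then have "?z \<noteq> 1" using \<rho> by auto
        moreover have "dist ?z 1 < d" using n \<rho> by (simp only: dist_norm)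
        ultimately have "dist ((?z - 1)\<^sup>2 * QW w1 w2 w3 ?z) (of_real (w2 / 16)) < \<delta>" by (rule d(2))
        then show ?thesis by (simp only: dist_norm)
      qed
      ultimately show "\<exists>\<rho> T. \<rho> \<noteq> 0 \<and> transport A (circle 1 \<rho>) 0 1 T \<and> trace T = trace T1 \<and>
          (\<forall>t. norm ((circle 1 \<rho> t - 1)\<^sup>2 * QW w1 w2 w3 (circle 1 \<rho> t) - of_real (w2 / 16)) < \<delta>)"
        using T(1) \<rho>(1) by (intro exI[of _ "of_real (- \<rho>)"] exI[of _ T]) simp
    qed
    show "trace (T0 ** T1) = of_real (2 * cos (2 * pi * nn (s * w3)))"
    proof (rule trace_eq_by_circles[OF w(3), of 0])
      fix \<delta> :: real assume "\<delta> > 0"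
      then have "eventually (\<lambda>z. dist (z\<^sup>2 * QW w1 w2 w3 z) (of_real (w3 / 16)) < \<delta>) at_infinity"
        by (rule tendstoD[OF QW_tendsto(3)])
      then obtain d where d: "\<And>z. d \<le> norm z \<Longrightarrow> dist (z\<^sup>2 * QW w1 w2 w3 z) (of_real (w3 / 16)) < \<delta>"
        unfolding eventually_at_infinity by auto
      \<comment> \<open>A radius above 1 makes the circle cross the real axis in the intervals of
        -1/2 and 3/2.\<close>
      define \<rho> where "\<rho> = max d 2"
      have \<rho>: "\<rho> > 1" "d \<le> \<rho>" by (auto simp: \<rho>_def)
      obtain T where T: "transport A (circle 0 (of_real \<rho>)) 0 1 T" "trace T = trace (C (Re 0 - \<rho>) ** adj2 (C (Re 0 + \<rho>)))"
        using up[of 0 \<rho>] \<rho> by auto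
      have "trace T = trace (T0 ** T1)"
        using T(2) C_eq[of "- \<rho>" "-1/2"] C_eq[of \<rho> "3/2"] \<rho> unfolding trT01 by simp
      moreover have "norm ((circle 0 (of_real \<rho>) t - 0)\<^sup>2 * QW w1 w2 w3 (circle 0 (of_real \<rho>) t) - of_real (w3 / 16)) < \<delta>" for t
        using d[of "circle 0 (of_real \<rho>) t"] norm_circle[of 0 "of_real \<rho>" t] \<rho> by (auto simp: dist_norm)
      ultimately show "\<exists>\<rho> T'. \<rho> \<noteq> 0 \<and> transport A (circle 0 \<rho>) 0 1 T' \<and> trace T' = trace (T0 ** T1) \<and>
          (\<forall>t. norm ((circle 0 \<rho> t - 0)\<^sup>2 * QW w1 w2 w3 (circle 0 \<rho> t) - of_real (w3 / 16)) < \<delta>)"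
        using T(1) \<rho>(1) by (intro exI[of _ "of_real \<rho>"] exI[of _ T]) auto
    qed
  qed
qed

text \<open>The initial value X acts by simultaneous conjugation, which changes neither the
  determinants and traces nor the relation between the three transports.\<close>

lemma monodromy_good_iff:
  assumes X: "invertible X"
  defines "Ms \<equiv> {monodromy A loop0 X, monodromy A loop1 X, monodromy A loopinf X}"
  shows "nondegenerate Ms \<and> simult_unitarizable Ms \<longleftrightarrow> trinoid_discr w1 w2 w3 s > 0"
proof -
  obtain T0 T1 Ti where T:
    "transport A loop0 0 1 T0" "transport A loop1 0 1 T1" "transport A loopinf 0 1 Ti"
    "det T0 = 1" "det T1 = 1" "T0 ** T1 ** Ti = mat 1"
    "trace T0 = of_real (2 * cos (2 * pi * nn (s * w1)))"
    "trace T1 = of_real (2 * cos (2 * pi * nn (s * w2)))"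
    "trace (T0 ** T1) = of_real (2 * cos (2 * pi * nn (s * w3)))"
    by (rule transports)
  let ?c = "\<lambda>T. X ** T ** matrix_inv X"
  have Ms: "Ms = {?c T0, ?c T1, ?c Ti}" unfolding Ms_def using T(1-3) by (simp add: monodromy_eq)
  show ?thesis unfolding Ms trinoid_discr_def discr_def
  proof (rule nondegenerate_unitarizable_iff)
    show "?c T0 ** ?c T1 ** ?c Ti = mat 1"
      unfolding conj_mult[OF X, symmetric] T(6) using X by (simp add: matrix_inv_mult)
    show "trace (?c T0 ** ?c T1) = of_real (2 * cos (2 * pi * nn (s * w3)))"
      unfolding conj_mult[OF X, symmetric] trace_conj[OF X] by (rule T(9))
  qed (simp_all only: det_conj[OF X] trace_conj[OF X] T abs_cos_le_one)
qed

end

section \<open>Passage between lambda and s\<close>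

lemma finite_unit_circle_Re:
  assumes "finite Z"
  shows "finite {lam :: complex. norm lam = 1 \<and> (1 - Re lam) / 2 \<in> Z}"
proof (rule finite_subset)
  let ?f = "\<lambda>(e, s). Complex (1 - 2 * s) (e * sqrt (1 - (1 - 2 * s)\<^sup>2))"
  show "{lam. norm lam = 1 \<and> (1 - Re lam) / 2 \<in> Z} \<subseteq> ?f ` ({-1, 1} \<times> Z)"
  proof
    fix lam :: complex assume lam: "lam \<in> {lam. norm lam = 1 \<and> (1 - Re lam) / 2 \<in> Z}"
    then have "(Re lam)\<^sup>2 + (Im lam)\<^sup>2 = 1" using cmod_power2[of lam] by simp
    then have "1 - (Re lam)\<^sup>2 = (Im lam)\<^sup>2" by simp
    then have "sqrt (1 - (Re lam)\<^sup>2) = \<bar>Im lam\<bar>" by simp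
    then have "Im lam = (if Im lam < 0 then -1 else 1) * sqrt (1 - (Re lam)\<^sup>2)" by simp
    moreover have "1 - 2 * ((1 - Re lam) / 2) = Re lam" by (simp add: field_simps)
    ultimately have "lam = ?f (if Im lam < 0 then -1 else 1, (1 - Re lam) / 2)"
      by (simp only: prod.case complex_eq_iff complex.sel)
    moreover have "(if Im lam < 0 then -1 else 1, (1 - Re lam) / 2) \<in> {-1, 1::real} \<times> Z"
      using lam by simp
    ultimately show "lam \<in> ?f ` ({-1, 1} \<times> Z)" by (rule image_eqI)
  qed
  show "finite (?f ` ({-1, 1} \<times> Z))" using assms by simp
qed

lemma unit_circle_Re_surj:
  assumes "0 \<le> s" "s \<le> 1"
  obtains lam :: complex where "norm lam = 1" "(1 - Re lam) / 2 = s"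
proof
  have "\<bar>1 - 2 * s\<bar> \<le> 1" using assms by auto
  then have "(1 - 2 * s)\<^sup>2 \<le> 1" by (simp add: abs_square_le_1)
  then show "norm (Complex (1 - 2 * s) (sqrt (1 - (1 - 2 * s)\<^sup>2))) = 1" by (simp add: cmod_def)
qed simp

theorem mainTheorem4:
  fixes w1 w2 w3 :: real and Phi0 :: "complex \<Rightarrow> complex^2^2"
  assumes "w1 < 1" "w1 \<noteq> 0" "w2 < 1" "w2 \<noteq> 0" "w3 < 1" "w3 \<noteq> 0"
    and "\<And>i j. (\<lambda>lam. Phi0 lam $ i $ j) holomorphic_on (- {0})"
    and "\<And>lam. lam \<noteq> 0 \<Longrightarrow> invertible (Phi0 lam)"
  defines "M1 \<equiv> \<lambda>lam. monodromy (trinoid_pot w1 w2 w3 lam) loop0 (Phi0 lam)"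
    and "M2 \<equiv> \<lambda>lam. monodromy (trinoid_pot w1 w2 w3 lam) loop1 (Phi0 lam)"
    and "M3 \<equiv> \<lambda>lam. monodromy (trinoid_pot w1 w2 w3 lam) loopinf (Phi0 lam)"
  shows "trinoid_ineqs w1 w2 w3 \<longleftrightarrow>
    (\<exists>S. finite S \<and> S \<subseteq> sphere 0 1 \<and>
       (\<forall>lam \<in> sphere 0 1 - S.
          nondegenerate {M1 lam, M2 lam, M3 lam} \<and>
          simult_unitarizable {M1 lam, M2 lam, M3 lam}))"
proof -
  have good: "nondegenerate {M1 lam, M2 lam, M3 lam} \<and> simult_unitarizable {M1 lam, M2 lam, M3 lam} \<longleftrightarrow>
      trinoid_discr w1 w2 w3 ((1 - Re lam) / 2) > 0" if lam: "norm lam = 1" for lam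
  proof -
    interpret trinoid_unit_circle w1 w2 w3 lam
      by unfold_locales (use assms(1,3,5) lam in auto)
    have "lam \<noteq> 0" using lam by auto
    then have "invertible (Phi0 lam)" by (rule assms(8))
    then show ?thesis unfolding M1_def M2_def M3_def s_def[symmetric] by (rule monodromy_good_iff)
  qed
  show ?thesis
  proof
    assume ineqs: "trinoid_ineqs w1 w2 w3"
    \<comment> \<open>The points lambda = 1 and lambda = -1: the discriminant vanishes at s = 0, and
      it vanishes at s = 1 if an inequality for the n_j is an equality.\<close>
    let ?S = "{lam :: complex. norm lam = 1 \<and> (1 - Re lam) / 2 \<in> {0, 1}}"
    have "finite ?S" by (rule finite_unit_circle_Re) simp
    moreover have "?S \<subseteq> sphere 0 1" by auto
    moreover have "nondegenerate {M1 lam, M2 lam, M3 lam} \<and> simult_unitarizable {M1 lam, M2 lam, M3 lam}"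
      if "lam \<in> sphere 0 1 - ?S" for lam
    proof -
      have lam: "norm lam = 1" "(1 - Re lam) / 2 \<noteq> 0" "(1 - Re lam) / 2 \<noteq> 1" using that by auto
      then have "0 < (1 - Re lam) / 2" "(1 - Re lam) / 2 < 1"
        using unit_circle_param(2,3)[OF lam(1)] by linarith+
      then show ?thesis using good[OF lam(1)] trinoid_discr_pos[OF assms(1-6) ineqs] by blast
    qed
    ultimately show "\<exists>S. finite S \<and> S \<subseteq> sphere 0 1 \<and> (\<forall>lam \<in> sphere 0 1 - S.
        nondegenerate {M1 lam, M2 lam, M3 lam} \<and> simult_unitarizable {M1 lam, M2 lam, M3 lam})"
      by blast
  next
    assume "\<exists>S. finite S \<and> S \<subseteq> sphere 0 1 \<and> (\<forall>lam \<in> sphere 0 1 - S.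
        nondegenerate {M1 lam, M2 lam, M3 lam} \<and> simult_unitarizable {M1 lam, M2 lam, M3 lam})"
    then obtain S where S: "finite S" "\<And>lam. lam \<in> sphere 0 1 - S \<Longrightarrow>
        nondegenerate {M1 lam, M2 lam, M3 lam} \<and> simult_unitarizable {M1 lam, M2 lam, M3 lam}"
      by blast
    show "trinoid_ineqs w1 w2 w3"
    proof (rule trinoid_ineqs_if_discr_pos[OF assms(1-6), of "(\<lambda>lam. (1 - Re lam) / 2) ` S"])
      fix s :: real assume s: "0 < s" "s < 1" "s \<notin> (\<lambda>lam. (1 - Re lam) / 2) ` S"
      obtain lam :: complex where lam: "norm lam = 1" "(1 - Re lam) / 2 = s"
        using unit_circle_Re_surj[of s] s by auto
      then have "lam \<notin> S" using s(3) by blast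
      then have "lam \<in> sphere 0 1 - S" using lam(1) by simp
      then show "trinoid_discr w1 w2 w3 s > 0" using S(2) good[OF lam(1)] lam(2) by blast
    qed (use S(1) in simp)
  qed
qed

end
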